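(* There are infinitely many positive integers that are both colossally abundant and GA1 numbers.
   Context: For an integer $n>1$ let $G(n)=\dfrac{\sigma(n)}{n\log\log n}$, where $\sigma(n)=\sum_{d\mid n}d$. A GA1 number is a composite integer $N$ such that $G(N)\ge G(N/p)$ for every prime $p$ dividing $N$. A positive integer $N$ is colossally abundant (CA) if there exists $\varepsilon>0$ such that $\dfrac{\sigma(N)}{N^{1+\varepsilon}}\ge\dfrac{\sigma(n)}{n^{1+\varepsilon}}$ for all integers $n>1$. *)

theory Defs
  imports Complex_Main "HOL-Computational_Algebra.Primes"
begin

(* Intended for n > 0 only: for n = 0 the index set is infinite and the sum is 0. *)
definition divisor_sigma :: "nat \<Rightarrow> nat" where
  "divisor_sigma n = (\<Sum>d | d dvd n. d)"

(* Intended for n > 1 only. Note that ln (ln 2) < 0, so gronwall_G 2 is negative. *)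
definition gronwall_G :: "nat \<Rightarrow> real" where
  "gronwall_G n = real (divisor_sigma n) / (real n * ln (ln (real n)))"

(* Since N is composite, N div p > 1 for each prime p dividing N, so gronwall_G is
   only evaluated on its intended domain. *)
definition GA1 :: "nat \<Rightarrow> bool" where
  "GA1 N \<longleftrightarrow> N > 1 \<and> \<not> prime N \<and>
     (\<forall>p. prime p \<and> p dvd N \<longrightarrow> gronwall_G N \<ge> gronwall_G (N div p))"

definition colossally_abundant :: "nat \<Rightarrow> bool" where
  "colossally_abundant N \<longleftrightarrow> N > 0 \<and>
     (\<exists>\<epsilon>::real. \<epsilon> > 0 \<and>
       (\<forall>n::nat. n > 1 \<longrightarrow>
          real (divisor_sigma N) / real N powr (1 + \<epsilon>)
            \<ge> real (divisor_sigma n) / real n powr (1 + \<epsilon>)))"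

end

(*
  Let N maximise sigma(n) / n^(1 + e) with e = 1 / ((x + 1) ln x). Comparing N with N p and N / p
  shows that every prime p <= x divides N, that p^2 divides N whenever 3 p^2 <= 4 x, and that no
  prime p > x + 1 divides N. Hence ln N >= theta(x) + theta(sqrt(4 x / 3)), and sigma(N) / N exceeds
  sigma(N / p) / (N / p) at least by the factor p^e. The function ln ln ln grows slowly enough that
  N is GA1 as soon as theta(x) + theta(sqrt(4 x / 3)) >= x + 1 + ln(x + 1).

  This inequality holds for arbitrarily large x. Otherwise u(x) = x + C x^(1/4) - theta(x) -
  theta(sqrt(4 x / 3)) is nonnegative on x >= 1 for some C, and with P(s) = sum_p ln p / p^s its
  Mellin transform is, up to a factor 1 / s,
    1 + Z'(s) / Z(s) + R(s) - ((4 / 3)^s - 1) P(2 s) + C s / (s - 1 / 4),   Z(s) = (s - 1) zeta(s),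
  where R is holomorphic for Re s > 1 / 3. As Z has no zero on the positive real axis, this is
  holomorphic near every real s > 1 / 2, so by Landau's lemma the Mellin integral converges there and
  is nonnegative. But P(2 s) tends to infinity as s decreases to 1 / 2.
*)
theory Submission
  imports Defs "HOL-Complex_Analysis.Complex_Analysis" "HOL-Real_Asymp.Real_Asymp"
begin

section \<open>Maximisers of \<open>\<sigma>(n) / n powr (1 + \<epsilon>)\<close>\<close>

text \<open>The obstacle is a bias of \<open>theta\<close>: among prime powers the squares account
  for about \<open>sqrt x\<close>, and \<open>theta x\<close> tends to fall short of
  \<open>x\<close> by that much. The prime squares dividing \<open>N\<close> have to make up for it,
  and \<open>theta (sqrt (4 * x / 3))\<close>, of size about \<open>sqrt (4 / 3) * sqrt x\<close>,
  does so with something to spare. The same balance decides the sign at the end: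
  \<open>Z' / Z\<close> carries the squares with weight 1, the transform of \<open>u\<close> carries
  them with weight \<open>(4 / 3) powr s\<close>, and the difference of the weights is positive at
  \<open>s = 1 / 2\<close>.

  The value of \<open>e\<close> serves twice. It turns the criterion for divisibility by
  \<open>p\<close> into an equality at \<open>p = x\<close>, and it bounds
  \<open>1 / (ln m * ln (ln m))\<close> for \<open>m = N / p\<close> once
  \<open>ln m >= x + 1\<close>. The summand \<open>ln (x + 1)\<close> of the inequality pays for the
  division by \<open>p\<close>.

  The term \<open>C * x powr (1 / 4)\<close> absorbs \<open>1 + ln (x + 1)\<close> and a bounded
  range of \<open>x\<close>, and its pole at \<open>1 / 4\<close> lies to the left of
  \<open>1 / 2\<close>.\<close>

lemma ln_less_minus_one:
  fixes x :: real
  assumes "x > 0" "x \<noteq> 1"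
  shows "ln x < x - 1"
  using ln_le_minus_one[OF assms(1)] ln_eq_minus_one[OF assms(1)] assms(2) by force

section \<open>Divisor sums at multiples of a prime, and their growth\<close>

lemma divisor_sigma_pos: "n > 0 \<Longrightarrow> divisor_sigma n > 0"
  unfolding divisor_sigma_def by (rule sum_pos2[where i = 1]) auto

text \<open>A divisor of \<open>p * m\<close> is either \<open>p\<close> times a divisor of
  \<open>m\<close>, or coprime to \<open>p\<close> and then a divisor of \<open>m\<close>. This
  yields both the general upper bound and the exact values for exponents 1 and 2.\<close>

lemma divisor_sigma_prime_times:
  assumes "prime p" "m > 0"
  shows "divisor_sigma (p * m) = p * divisor_sigma m + (\<Sum>d | d dvd m \<and> \<not> p dvd d. d)"
proof -
  have p: "p > 0" using assms(1) prime_gt_0_nat by blast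
  have split: "{d. d dvd p * m} = (\<lambda>d. p * d) ` {d. d dvd m} \<union> {d. d dvd m \<and> \<not> p dvd d}"
  proof (intro equalityI subsetI)
    fix d assume "d \<in> {d. d dvd p * m}"
    then have d: "d dvd p * m" by simp
    show "d \<in> (\<lambda>d. p * d) ` {d. d dvd m} \<union> {d. d dvd m \<and> \<not> p dvd d}"
    proof (cases "p dvd d")
      case True
      then obtain e where "d = p * e" by (elim dvdE)
      then show ?thesis using d p by auto
    next
      case False
      then have "coprime d p"
        using assms(1) prime_imp_coprime coprime_commute by blast
      then have "d dvd m" using d coprime_dvd_mult_right_iff by blast
      then show ?thesis using False by simp
    qed
  qed auto
  have fin: "finite {d. d dvd m}" using assms(2) by simp
  have "divisor_sigma (p * m) = (\<Sum>d\<in>(\<lambda>d. p * d) ` {d. d dvd m}. d) + (\<Sum>d | d dvd m \<and> \<not> p dvd d. d)"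
    unfolding divisor_sigma_def split by (rule sum.union_disjoint) (use fin in auto)
  also have "(\<Sum>d\<in>(\<lambda>d. p * d) ` {d. d dvd m}. d) = p * divisor_sigma m"
    unfolding divisor_sigma_def
    by (subst sum.reindex) (use p in \<open>auto simp: inj_on_def sum_distrib_left\<close>)
  finally show ?thesis .
qed

lemma divisor_sigma_prime_times_le:
  assumes "prime p" "m > 0"
  shows "divisor_sigma (p * m) \<le> (p + 1) * divisor_sigma m"
proof -
  have "(\<Sum>d | d dvd m \<and> \<not> p dvd d. d) \<le> divisor_sigma m"
    unfolding divisor_sigma_def by (rule sum_mono2) (use assms(2) in auto)
  then show ?thesis using divisor_sigma_prime_times[OF assms] by simp
qed

lemma divisor_sigma_prime_times_coprime:
  assumes "prime p" "m > 0" "\<not> p dvd m"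
  shows "divisor_sigma (p * m) = (p + 1) * divisor_sigma m"
proof -
  have "{d. d dvd m \<and> \<not> p dvd d} = {d. d dvd m}" using assms(3) dvd_trans by blast
  then show ?thesis
    using divisor_sigma_prime_times[OF assms(1,2)] by (simp add: divisor_sigma_def)
qed

lemma divisor_sigma_prime_square_times_coprime:
  assumes "prime p" "m > 0" "\<not> p dvd m"
  shows "divisor_sigma (p * (p * m)) = (p * (p + 1) + 1) * divisor_sigma m"
proof -
  have p: "p > 0" using assms(1) prime_gt_0_nat by blast
  have "{d. d dvd p * m \<and> \<not> p dvd d} = {d. d dvd m}"
  proof (intro equalityI subsetI)
    fix d assume "d \<in> {d. d dvd p * m \<and> \<not> p dvd d}"
    then have "d dvd p * m" "coprime d p"
      using assms(1) prime_imp_coprime coprime_commute by blast+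
    then show "d \<in> {d. d dvd m}" using coprime_dvd_mult_right_iff by blast
  next
    fix d assume "d \<in> {d. d dvd m}"
    then show "d \<in> {d. d dvd p * m \<and> \<not> p dvd d}" using assms(3) dvd_trans by auto
  qed
  then have "(\<Sum>d | d dvd p * m \<and> \<not> p dvd d. d) = divisor_sigma m"
    by (simp add: divisor_sigma_def)
  then show ?thesis
    using divisor_sigma_prime_times[OF assms(1), of "p * m"] assms p
      divisor_sigma_prime_times_coprime[OF assms]
    by (simp add: algebra_simps)
qed

text \<open>Passing to complementary divisors gives \<open>n\<close> times the sum of
  \<open>1 / d\<close>; letting \<open>d\<close> run up to \<open>n\<close> turns this into a
  harmonic number. A logarithmic bound suffices for the maximised quotient to tend to 0.\<close>

lemma divisor_sigma_le:
  assumes "n > 0"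
  shows "real (divisor_sigma n) \<le> real n * (1 + ln (real n))"
proof -
  have "real (divisor_sigma n) = (\<Sum>d | d dvd n. real (n div d))"
    unfolding divisor_sigma_def of_nat_sum
    by (rule sum.reindex_bij_witness[where i = "\<lambda>d. n div d" and j = "\<lambda>d. n div d"])
      (use assms in \<open>auto simp: div_dvd_iff_mult\<close>)
  also have "\<dots> = (\<Sum>d | d dvd n. real n * (1 / real d))"
    by (rule sum.cong) (auto simp: real_of_nat_div)
  also have "\<dots> \<le> (\<Sum>d\<in>{1..n}. real n * (1 / real d))"
    by (rule sum_mono2) (use assms in \<open>auto dest: dvd_imp_le intro!: Nat.gr0I\<close>)
  also have "\<dots> = real n * harm n"
    by (simp add: harm_def sum_distrib_left divide_inverse)
  \<comment> \<open>\<open>harm n - ln n\<close> decreases from its value 1 at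
    \<open>n = 1\<close>.\<close>
  also have "\<dots> \<le> real n * (1 + ln (real n))"
    using euler_mascheroni_sequence_decreasing[of 1 n] assms
    by (intro mult_left_mono) (auto simp: harm_def)
  finally show ?thesis .
qed

text \<open>Unlike in \<open>colossally_abundant\<close>, \<open>e\<close> is fixed and
  \<open>n = 1\<close> takes part, so that the comparison with \<open>N / p\<close> is allowed even
  when \<open>N = p\<close>.\<close>

definition sigma_maximiser :: "real \<Rightarrow> nat \<Rightarrow> bool" where
  "sigma_maximiser e N \<longleftrightarrow> N > 0 \<and> (\<forall>n>0.
     real (divisor_sigma n) / real n powr (1 + e) \<le> real (divisor_sigma N) / real N powr (1 + e))"

lemma sigma_maximiser_exists:
  assumes "e > 0"
  obtains N where "sigma_maximiser e N"
proof -
  define f where "f n = real (divisor_sigma n) / real n powr (1 + e)" for n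
  have "((\<lambda>n. (1 + ln (real n)) / real n powr e) \<longlongrightarrow> 0) sequentially"
    using assms by real_asymp
  \<comment> \<open>The threshold 1 is the value of the quotient at \<open>n = 1\<close>, so a
    maximum over an initial segment is global.\<close>
  then have "eventually (\<lambda>n. (1 + ln (real n)) / real n powr e < 1) sequentially"
    by (rule order_tendstoD) simp
  then obtain M where M: "\<And>n. n \<ge> M \<Longrightarrow> (1 + ln (real n)) / real n powr e < 1"
    by (auto simp: eventually_sequentially)
  have tail: "f n < 1" if "n \<ge> M" "n > 0" for n
  proof -
    have "f n \<le> real n * (1 + ln (real n)) / real n powr (1 + e)"
      unfolding f_def using divisor_sigma_le[OF that(2)] by (intro divide_right_mono) auto
    also have "\<dots> = (1 + ln (real n)) / real n powr e"
      using that(2) by (simp add: powr_add)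
    finally show ?thesis using M[OF that(1)] by simp
  qed
  have f1: "f 1 = 1" by (simp add: f_def divisor_sigma_def)
  define A where "A = {1..M + 1}"
  have "finite (f ` A)" "f ` A \<noteq> {}" by (auto simp: A_def)
  then obtain N where N: "N \<in> A" "f N = Max (f ` A)" using Max_in by (metis imageE)
  have "f n \<le> f N" if "n > 0" for n
  proof (cases "n \<in> A")
    case True
    then show ?thesis using N by (simp add: A_def)
  next
    case False
    then have "f n < 1" using that by (intro tail) (auto simp: A_def)
    moreover have "f 1 \<le> f N" unfolding N(2) by (intro Max_ge) (auto simp: A_def)
    ultimately show ?thesis using f1 by simp
  qed
  then have "sigma_maximiser e N" using N(1) unfolding sigma_maximiser_def f_def A_def by auto
  then show ?thesis by (rule that)
qed

section \<open>Comparing a maximiser with its neighbours \<open>N * p\<close> and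
  \<open>N / p\<close>\<close>

context
  fixes e :: real and N p :: nat
  assumes max: "sigma_maximiser e N" and p: "prime p"
begin

lemma sigma_maximiser_times_le:
  "real (divisor_sigma (p * N)) \<le> real p powr (1 + e) * real (divisor_sigma N)"
proof -
  have N: "N > 0" and p0: "p > 0" using max p prime_gt_0_nat by (auto simp: sigma_maximiser_def)
  have "real (divisor_sigma (p * N)) / real (p * N) powr (1 + e) \<le> real (divisor_sigma N) / real N powr (1 + e)"
    using max N p0 unfolding sigma_maximiser_def by (simp del: of_nat_mult)
  then show ?thesis using N p0 by (simp add: powr_mult field_simps)
qed

lemma sigma_maximiser_div_ge:
  assumes "N = p * m"
  shows "real p powr (1 + e) * real (divisor_sigma m) \<le> real (divisor_sigma N)"
proof -
  have N: "m > 0" and p0: "p > 0"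
    using max p prime_gt_0_nat assms by (auto simp: sigma_maximiser_def)
  have "real (divisor_sigma m) / real m powr (1 + e) \<le> real (divisor_sigma (p * m)) / real (p * m) powr (1 + e)"
    using max N unfolding sigma_maximiser_def assms by (simp del: of_nat_mult)
  then show ?thesis using N p0 assms by (simp add: powr_mult field_simps)
qed

text \<open>If \<open>p\<close> did not divide \<open>N\<close>, passing to \<open>p * N\<close>
  would multiply the divisor sum by exactly \<open>p + 1\<close>, so maximality would give
  \<open>ln (1 + 1 / p) <= e * ln p\<close>. But \<open>ln (1 + 1 / p)\<close> is strictly larger
  than \<open>1 / (p + 1)\<close>; the strictness lets the criterion include equality.\<close>

lemma sigma_maximiser_dvd:
  assumes "e * ln (real p) \<le> 1 / (real p + 1)"
  shows "p dvd N"
proof (rule ccontr)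
  assume ndvd: "\<not> p dvd N"
  have N: "N > 0" and p0: "real p > 0" using max p prime_gt_0_nat by (auto simp: sigma_maximiser_def)
  have "(real p + 1) * real (divisor_sigma N) \<le> real p powr (1 + e) * real (divisor_sigma N)"
    using sigma_maximiser_times_le divisor_sigma_prime_times_coprime[OF p N ndvd] by (simp add: algebra_simps)
  then have "real p + 1 \<le> real p powr (1 + e)"
    using divisor_sigma_pos[OF N] by simp
  then have "ln (real p + 1) \<le> ln (real p powr (1 + e))"
    using p0 by (subst ln_le_cancel_iff) auto
  then have "ln (real p + 1) \<le> (1 + e) * ln (real p)" using p0 by (simp add: ln_powr)
  moreover have "ln (real p) - ln (real p + 1) < real p / (real p + 1) - 1"
    using ln_less_minus_one[of "real p / (real p + 1)"] p0 by (simp add: ln_div)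
  moreover have "real p / (real p + 1) - 1 = - (1 / (real p + 1))" using p0 by (simp add: field_simps)
  ultimately show False using assms by (simp add: algebra_simps)
qed

text \<open>If \<open>p\<close> divided \<open>N\<close> exactly once, passing to
  \<open>p * N\<close> would multiply \<open>sigma(n) / n\<close> by \<open>(b + 1) / b\<close> with
  \<open>b = p * (p + 1)\<close>, and \<open>ln ((b + 1) / b) > 1 / (b + 1)\<close>.\<close>

lemma sigma_maximiser_square_dvd:
  assumes "p dvd N" "e * ln (real p) \<le> 1 / (real p * (real p + 1) + 1)"
  shows "p ^ 2 dvd N"
proof (rule ccontr)
  assume ndvd: "\<not> p ^ 2 dvd N"
  obtain m where m: "N = p * m" using assms(1) by (elim dvdE)
  have m0: "m > 0" and p0: "real p > 0"
    using max p prime_gt_0_nat m by (auto simp: sigma_maximiser_def)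
  have nd: "\<not> p dvd m" using ndvd m by (auto simp: power2_eq_square)
  define b where "b = real p * (real p + 1)"
  have b: "b > 0" using p0 by (simp add: b_def)
  have "(b + 1) * real (divisor_sigma m) \<le> real p powr (1 + e) * ((real p + 1) * real (divisor_sigma m))"
    using sigma_maximiser_times_le
    unfolding m divisor_sigma_prime_square_times_coprime[OF p m0 nd]
      divisor_sigma_prime_times_coprime[OF p m0 nd]
    by (simp add: b_def algebra_simps)
  then have "b + 1 \<le> real p powr (1 + e) * (real p + 1)"
    using divisor_sigma_pos[OF m0] by simp
  then have "b + 1 \<le> real p powr e * b"
    using p0 by (simp add: powr_add b_def algebra_simps)
  then have "ln (b + 1) \<le> ln (real p powr e * b)"
    using b p0 by (subst ln_le_cancel_iff) auto
  also have "\<dots> = e * ln (real p) + ln b"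
    using b p0 by (simp add: ln_mult ln_powr)
  finally have "ln (b + 1) \<le> e * ln (real p) + ln b" .
  moreover have "ln b - ln (b + 1) < b / (b + 1) - 1"
    using ln_less_minus_one[of "b / (b + 1)"] b by (simp add: ln_div)
  moreover have "b / (b + 1) - 1 = - (1 / (b + 1))" using b by (simp add: field_simps)
  ultimately show False using assms(2) by (simp add: b_def)
qed

text \<open>Removing one factor \<open>p\<close> lowers the divisor sum by a factor of at most
  \<open>p + 1\<close>, whatever the exponent of \<open>p\<close>. Maximality then gives
  \<open>e * ln p <= ln (1 + 1 / p) <= 1 / p\<close>.\<close>

lemma sigma_maximiser_prime_dvd_bound:
  assumes "p dvd N"
  shows "e * real p * ln (real p) \<le> 1"
proof -
  obtain m where m: "N = p * m" using assms by (elim dvdE)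
  have m0: "m > 0" and p0: "real p > 0"
    using max p prime_gt_0_nat m by (auto simp: sigma_maximiser_def)
  have "real p powr (1 + e) * real (divisor_sigma m) \<le> real (divisor_sigma N)"
    by (rule sigma_maximiser_div_ge[OF m])
  also have "\<dots> \<le> real ((p + 1) * divisor_sigma m)"
    unfolding m by (rule of_nat_mono) (rule divisor_sigma_prime_times_le[OF p m0])
  also have "\<dots> = (real p + 1) * real (divisor_sigma m)" by (simp add: algebra_simps)
  finally have "real p powr (1 + e) \<le> real p + 1"
    using divisor_sigma_pos[OF m0] by simp
  then have "ln (real p powr (1 + e)) \<le> ln (real p + 1)"
    using p0 by (subst ln_le_cancel_iff) auto
  then have "(1 + e) * ln (real p) \<le> ln (real p + 1)" using p0 by (simp add: ln_powr)
  moreover have "ln (real p + 1) - ln (real p) \<le> (real p + 1) / real p - 1"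
    using ln_le_minus_one[of "(real p + 1) / real p"] p0 by (simp add: ln_div)
  moreover have "(real p + 1) / real p - 1 = 1 / real p" using p0 by (simp add: field_simps)
  ultimately have "e * ln (real p) \<le> 1 / real p"
    by (simp add: algebra_simps)
  then show ?thesis using p0 by (simp add: field_simps)
qed

end

section \<open>Chebyshev's function and the GA1 property of a maximiser\<close>

definition theta :: "real \<Rightarrow> real" where
  "theta x = (\<Sum>p | prime p \<and> real p \<le> x. ln (real p))"

lemma finite_primes_le: "finite {p::nat. prime p \<and> real p \<le> x}"
  by (rule finite_subset[of _ "{..nat \<lfloor>x\<rfloor>}"]) (auto simp: le_nat_floor)

lemma prod_prime_powers_dvd:
  fixes N :: nat
  assumes "finite A" "\<And>p. p \<in> A \<Longrightarrow> prime p" "\<And>p. p \<in> A \<Longrightarrow> p ^ k p dvd N"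
  shows "(\<Prod>p\<in>A. p ^ k p) dvd N"
  using assms
proof (induction A rule: finite_induct)
  case (insert p A)
  have "coprime (p ^ k p) (\<Prod>p\<in>A. p ^ k p)"
    using insert.hyps insert.prems
    by (intro prod_coprime_right coprime_power_left_iff[THEN iffD2] coprime_power_right_iff[THEN iffD2] disjI1)
      (metis insertI1 insertI2 primes_coprime)
  then show ?case using insert by (auto intro: divides_mult)
qed simp

text \<open>The product of the primes up to \<open>x\<close>, with those up to \<open>y\<close>
  squared, divides \<open>N\<close>. A squared prime is counted once in each of the two
  \<open>theta\<close> values.\<close>

lemma theta_add_theta_le_ln:
  fixes N :: nat
  assumes "N > 0" "y \<le> x"
    and "\<And>p. prime p \<Longrightarrow> real p \<le> x \<Longrightarrow> p dvd N"
    and "\<And>p. prime p \<Longrightarrow> real p \<le> y \<Longrightarrow> p ^ 2 dvd N"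
  shows "theta x + theta y \<le> ln (real N)"
proof -
  define A where "A = {p::nat. prime p \<and> real p \<le> x}"
  define k where "k p = (if real p \<le> y then 2 else 1 :: nat)" for p :: nat
  have fin: "finite A" unfolding A_def by (rule finite_primes_le)
  have sub: "{p::nat. prime p \<and> real p \<le> y} = {p \<in> A. real p \<le> y}"
    using assms(2) by (auto simp: A_def)
  have "(\<Prod>p\<in>A. p ^ k p) dvd N"
    by (rule prod_prime_powers_dvd) (use assms(3,4) fin in \<open>auto simp: A_def k_def\<close>)
  then have "(\<Prod>p\<in>A. p ^ k p) \<le> N" using assms(1) by (rule dvd_imp_le)
  then have "(\<Prod>p\<in>A. real p ^ k p) \<le> real N"
    by (metis (no_types, lifting) of_nat_le_iff of_nat_power of_nat_prod prod.cong)
  moreover have pos: "real p > 0" if "p \<in> A" for p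
    using that prime_gt_0_nat by (auto simp: A_def)
  ultimately have "ln (\<Prod>p\<in>A. real p ^ k p) \<le> ln (real N)"
    using assms(1) by (subst ln_le_cancel_iff) (auto intro!: prod_pos)
  moreover have "ln (\<Prod>p\<in>A. real p ^ k p) = (\<Sum>p\<in>A. real (k p) * ln (real p))"
    using fin pos by (subst ln_prod) (auto simp: ln_realpow)
  moreover have "\<dots> = (\<Sum>p\<in>A. ln (real p) + (if real p \<le> y then ln (real p) else 0))"
    by (rule sum.cong) (auto simp: k_def)
  moreover have "\<dots> = theta x + theta y"
    unfolding theta_def sub using fin by (subst sum.inter_filter) (auto simp: sum.distrib A_def)
  ultimately show ?thesis by simp
qed

text \<open>Two uses of \<open>ln t <= t - 1\<close>. With \<open>a = ln (N / p)\<close> and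
  \<open>b = ln N\<close> it controls the growth of the triple logarithm from \<open>N / p\<close>
  to \<open>N\<close>.\<close>

lemma ln_ln_diff_le:
  fixes a b :: real
  assumes "a > 1" "a \<le> b"
  shows "ln (ln b) - ln (ln a) \<le> (b - a) / (a * ln a)"
proof -
  have la: "ln a > 0" using assms(1) by simp
  have lb: "ln b > 0" using assms by (intro ln_gt_zero) linarith
  have "ln (ln b) - ln (ln a) = ln (ln b / ln a)" using la lb by (simp add: ln_div)
  also have "\<dots> \<le> ln b / ln a - 1" using la lb by (intro ln_le_minus_one) simp
  also have "\<dots> = ln (b / a) / ln a" using la assms by (simp add: ln_div field_simps)
  also have "\<dots> \<le> (b / a - 1) / ln a"
    using la assms by (intro divide_right_mono ln_le_minus_one) auto
  also have "\<dots> = (b - a) / (a * ln a)" using assms la by (simp add: field_simps)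
  finally show ?thesis .
qed

text \<open>Any constant strictly between 1 and 2 could replace \<open>4 / 3\<close>: the divisibility by squares of
  primes needs it below 2, and the oscillation of \<open>theta\<close> needs it above 1.\<close>

context
  fixes x e :: real and N :: nat
  assumes x: "x \<ge> 3" and e: "e = 1 / ((x + 1) * ln x)" and max: "sigma_maximiser e N"
    and large: "(4 * x / 3 + sqrt (4 * x / 3) + 1) * ln (sqrt (4 * x / 3)) \<le> (x + 1) * ln x"
begin

text \<open>The choice of \<open>e\<close> makes the criterion
  \<open>e * ln p <= 1 / (p + 1)\<close> an equality at \<open>p = x\<close>; its left side grows
  with \<open>p\<close> while its right side falls.\<close>

lemma sigma_maximiser_dvd_of_le:
  assumes p: "prime p" "real p \<le> x"
  shows "p dvd N"
proof (rule sigma_maximiser_dvd[OF max p(1)])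
  have p1: "real p > 1" using p prime_gt_1_nat by simp
  have l: "ln (real p) \<le> ln x" using p1 p(2) by simp
  have "e * ln (real p) \<le> e * ln x" unfolding e using x l by (intro mult_left_mono) auto
  also have "\<dots> = 1 / (x + 1)" unfolding e using x by simp
  also have "\<dots> \<le> 1 / (real p + 1)" using p1 p(2) by (intro divide_left_mono) auto
  finally show "e * ln (real p) \<le> 1 / (real p + 1)" .
qed

lemma sqrt_four_thirds_le: "sqrt (4 * x / 3) \<le> x"
  using x by (intro real_le_lsqrt) (auto simp: power2_eq_square)

text \<open>The criterion amounts to \<open>(p * (p + 1) + 1) * ln p <= (x + 1) * ln x\<close>. Its
  left side increases in \<open>p\<close>, and at \<open>p = sqrt (4 * x / 3)\<close> it is the
  assumption \<open>large\<close>.\<close>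

lemma sigma_maximiser_square_dvd_of_le:
  assumes p: "prime p" "real p \<le> sqrt (4 * x / 3)"
  shows "p ^ 2 dvd N"
proof (rule sigma_maximiser_square_dvd[OF max p(1)])
  have p1: "real p > 1" using p prime_gt_1_nat by simp
  show "p dvd N" using sigma_maximiser_dvd_of_le[OF p(1)] p(2) sqrt_four_thirds_le by simp
  have l: "ln (real p) \<le> ln (sqrt (4 * x / 3))" using p1 p(2) by (subst ln_le_cancel_iff) (use x in auto)
  have "real p * real p \<le> sqrt (4 * x / 3) * sqrt (4 * x / 3)"
    using p(2) x by (intro mult_mono) auto
  then have "real p * (real p + 1) + 1 \<le> 4 * x / 3 + sqrt (4 * x / 3) + 1"
    using p(2) x by (simp add: algebra_simps)
  then have "(real p * (real p + 1) + 1) * ln (real p) \<le> (4 * x / 3 + sqrt (4 * x / 3) + 1) * ln (sqrt (4 * x / 3))"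
    using l p1 x by (intro mult_mono) (auto intro!: add_nonneg_nonneg)
  also note large
  finally have "(real p * (real p + 1) + 1) * ln (real p) \<le> (x + 1) * ln x" .
  moreover have "(x + 1) * ln x > 0" using x by simp
  moreover have "real p * (real p + 1) + 1 > 0" using p1 by (simp add: add_pos_pos)
  ultimately show "e * ln (real p) \<le> 1 / (real p * (real p + 1) + 1)"
    unfolding e by (simp add: field_simps)
qed

lemma sigma_maximiser_prime_dvd_le:
  assumes p: "prime p" "p dvd N"
  shows "real p \<le> x + 1"
proof (rule ccontr)
  assume "\<not> real p \<le> x + 1"
  then have gt: "real p > x + 1" by simp
  have "(x + 1) * ln x < real p * ln (real p)"
    using gt x by (intro mult_strict_mono) auto
  moreover have "(x + 1) * ln x > 0" using x by simp
  ultimately have "e * real p * ln (real p) > 1" unfolding e by (simp add: field_simps)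
  then show False using sigma_maximiser_prime_dvd_bound[OF max p] by simp
qed

lemma sigma_maximiser_colossally_abundant: "colossally_abundant N"
proof -
  have "e > 0" unfolding e using x by simp
  then show ?thesis
    using max unfolding sigma_maximiser_def colossally_abundant_def by (intro conjI exI[of _ e]) auto
qed

text \<open>With \<open>m = N / p\<close> the claim compares two factors:
  \<open>sigma(n) / n\<close> grows by at least \<open>p powr e\<close> from \<open>m\<close> to
  \<open>N\<close>, while \<open>ln (ln n)\<close> grows by at most
  \<open>exp (ln p / (ln m * ln (ln m)))\<close>. The second is at most \<open>p powr e\<close> once
  \<open>ln m >= x + 1\<close>, which \<open>big\<close> ensures because \<open>p <= x + 1\<close>.
  The bound \<open>ln N > x\<close> serves to produce infinitely many such \<open>N\<close>.\<close>

lemma sigma_maximiser_GA1: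
  assumes big: "theta x + theta (sqrt (4 * x / 3)) \<ge> x + 1 + ln (x + 1)"
  shows "GA1 N" "ln (real N) > x"
proof -
  have N: "N > 0" using max by (simp add: sigma_maximiser_def)
  have lnN: "ln (real N) \<ge> x + 1 + ln (x + 1)"
    using theta_add_theta_le_ln[OF N sqrt_four_thirds_le sigma_maximiser_dvd_of_le sigma_maximiser_square_dvd_of_le] big
    by linarith
  moreover have "ln (x + 1) > 0" using x by simp
  ultimately show "ln (real N) > x" by linarith
  \<comment> \<open>Two distinct prime divisors exclude that \<open>N\<close> is prime;
    \<open>x >= 3\<close> is used for the divisor 3.\<close>
  have "2 dvd N" "3 dvd N"
    using sigma_maximiser_dvd_of_le[of 2] sigma_maximiser_dvd_of_le[of 3] x by auto
  then have "\<not> prime N" by (auto dest: primes_dvd_imp_eq[rotated 2])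
  moreover have "N > 1" using \<open>2 dvd N\<close> N by (auto dest: dvd_imp_le)
  moreover have "gronwall_G N \<ge> gronwall_G (N div p)" if p: "prime p" "p dvd N" for p
  proof -
    obtain m where m: "N = p * m" using p(2) by (elim dvdE)
    have p1: "real p > 1" using p prime_gt_1_nat by simp
    have m0: "m > 0" using N m by simp
    have lnm: "ln (real m) = ln (real N) - ln (real p)" using m p1 m0 by (simp add: ln_mult)
    have lnp: "ln (real p) \<le> ln (x + 1)"
      using sigma_maximiser_prime_dvd_le[OF p] p1 by simp
    have am: "ln (real m) \<ge> x + 1" using lnN lnm lnp by linarith
    have llm: "ln (ln (real m)) > 0" using am x by simp
    have "ln (ln (ln (real N))) - ln (ln (ln (real m))) \<le> ln (real p) / (ln (real m) * ln (ln (real m)))"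
      using ln_ln_diff_le[of "ln (real m)" "ln (real N)"] am x lnm p1 by simp
    also have "\<dots> \<le> ln (real p) / ((x + 1) * ln x)"
      using am x p1 llm by (intro divide_left_mono mult_mono mult_pos_pos) auto
    finally have d: "ln (ln (ln (real N))) - ln (ln (ln (real m))) \<le> e * ln (real p)" by (simp add: e)
    have llN: "ln (ln (real N)) > 0" using lnN x \<open>ln (x + 1) > 0\<close> by (intro ln_gt_zero) linarith
    have "ln (ln (real N)) = ln (ln (real m)) * exp (ln (ln (ln (real N))) - ln (ln (ln (real m))))"
      using llN llm by (simp add: exp_diff)
    also have "\<dots> \<le> ln (ln (real m)) * real p powr e"
      using d llm p1 by (intro mult_left_mono) (auto simp: powr_def)
    finally have le: "ln (ln (real N)) \<le> ln (ln (real m)) * real p powr e" .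
    have "real (divisor_sigma m) * (real p * ln (ln (real N)))
        \<le> real (divisor_sigma m) * (real p * (ln (ln (real m)) * real p powr e))"
      using le by (intro mult_left_mono) auto
    also have "\<dots> = (real p powr (1 + e) * real (divisor_sigma m)) * ln (ln (real m))"
      using p1 by (simp add: powr_add)
    also have "\<dots> \<le> real (divisor_sigma N) * ln (ln (real m))"
      using sigma_maximiser_div_ge[OF max p(1) m] llm by (intro mult_right_mono) auto
    finally have "real (divisor_sigma m) * (real p * ln (ln (real N))) \<le> real (divisor_sigma N) * ln (ln (real m))" .
    moreover have "real N = real p * real m" "N div p = m" using m p1 by auto
    ultimately show ?thesis
      using llm llN m0 p1 by (simp add: gronwall_G_def field_simps)
  qed
  ultimately show "GA1 N" by (auto simp: GA1_def)
qed

end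

lemma infinite_colossally_abundant_GA1I:
  assumes "\<And>M. \<exists>x\<ge>M. theta x + theta (sqrt (4 * x / 3)) \<ge> x + 1 + ln (x + 1)"
  shows "infinite {N::nat. colossally_abundant N \<and> GA1 N}"
proof
  assume fin: "finite {N::nat. colossally_abundant N \<and> GA1 N}"
  \<comment> \<open>The left side grows like \<open>2 / 3 * x * ln x\<close>, because
    \<open>ln (sqrt (4 * x / 3))\<close> is about half of \<open>ln x\<close>. A constant
    \<open>c < 2\<close> in place of \<open>4 / 3\<close> would give
    \<open>c / 2 < 1\<close>.\<close>
  have "eventually (\<lambda>x::real. (4 * x / 3 + sqrt (4 * x / 3) + 1) * ln (sqrt (4 * x / 3)) \<le> (x + 1) * ln x) at_top"
    by real_asymp
  then obtain K where K: "\<And>x::real. x \<ge> K \<Longrightarrow>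
      (4 * x / 3 + sqrt (4 * x / 3) + 1) * ln (sqrt (4 * x / 3)) \<le> (x + 1) * ln x"
    by (auto simp: eventually_at_top_linorder)
  \<comment> \<open>The sum bounds each of its terms, as \<open>GA1 N\<close> gives
    \<open>N > 1\<close> and hence \<open>ln N >= 0\<close>; the empty set is no special
    case.\<close>
  define B where "B = (\<Sum>N\<in>{N::nat. colossally_abundant N \<and> GA1 N}. ln (real N))"
  obtain x where x: "x \<ge> max (max K 3) B" "theta x + theta (sqrt (4 * x / 3)) \<ge> x + 1 + ln (x + 1)"
    using assms by blast
  define e where "e = 1 / ((x + 1) * ln x)"
  have "e > 0" using x(1) by (simp add: e_def)
  then obtain N where N: "sigma_maximiser e N" by (rule sigma_maximiser_exists)
  have x3: "x \<ge> 3" and xK: "x \<ge> K" and xB: "x \<ge> B" using x(1) by auto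
  have "colossally_abundant N \<and> GA1 N" and gt: "ln (real N) > x"
    using sigma_maximiser_colossally_abundant[OF x3 e_def N K[OF xK]]
      sigma_maximiser_GA1[OF x3 e_def N K[OF xK] x(2)] by auto
  then have "ln (real N) \<le> B"
    unfolding B_def using fin by (intro member_le_sum) (auto simp: GA1_def)
  then show False using gt xB by simp
qed

section \<open>Landau's lemma for Laplace transforms\<close>

text \<open>The exponent function \<open>l\<close> stands for the logarithm, so a Mellin transform
  is a Laplace transform without substitution. Values in \<open>ennreal\<close> make divergence an
  ordinary value.\<close>

definition laplace :: "'a measure \<Rightarrow> ('a \<Rightarrow> real) \<Rightarrow> ('a \<Rightarrow> real) \<Rightarrow> real \<Rightarrow> ennreal" where
  "laplace M w l s = (\<integral>\<^sup>+x. ennreal (w x * exp (- s * l x)) \<partial>M)"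

text \<open>Convergence and equality are bundled, and \<open>F\<close> is thereby real and
  nonnegative at \<open>s\<close>, which is what the final contradiction uses.\<close>

definition laplace_agrees ::
    "'a measure \<Rightarrow> ('a \<Rightarrow> real) \<Rightarrow> ('a \<Rightarrow> real) \<Rightarrow> (complex \<Rightarrow> complex) \<Rightarrow> real \<Rightarrow> bool" where
  "laplace_agrees M w l F s \<longleftrightarrow>
     (\<exists>y\<ge>0. laplace M w l s = ennreal y \<and> F (complex_of_real s) = complex_of_real y)"

text \<open>Moving left by \<open>t\<close> inserts \<open>exp (t * l x)\<close>, whose power series
  has nonnegative terms, so sum and integral may be exchanged.\<close>

lemma laplace_power_series:
  assumes [measurable]: "w \<in> borel_measurable M" "l \<in> borel_measurable M"
    and nn: "\<And>x. w x \<ge> 0" "\<And>x. l x \<ge> 0" and t: "t \<ge> 0"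
  shows "laplace M w l (a - t) =
    (\<Sum>k. (\<integral>\<^sup>+x. ennreal (w x * exp (- a * l x) * (l x ^ k / fact k)) \<partial>M) * ennreal (t ^ k))"
proof -
  have "laplace M w l (a - t) =
      (\<integral>\<^sup>+x. (\<Sum>k. ennreal (w x * exp (- a * l x) * (l x ^ k / fact k)) * ennreal (t ^ k)) \<partial>M)"
    unfolding laplace_def
  proof (rule nn_integral_cong)
    fix x
    have "(\<lambda>k. (w x * exp (- a * l x)) * (inverse (fact k) * (t * l x) ^ k))
        sums (w x * exp (- a * l x) * exp (t * l x))"
      using exp_converges[of "t * l x"] by (intro sums_mult) (simp add: field_simps)
    also have "w x * exp (- a * l x) * exp (t * l x) = w x * exp (- (a - t) * l x)"
      by (simp add: exp_add[symmetric] algebra_simps)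
    finally have "(\<lambda>k. ennreal ((w x * exp (- a * l x)) * (inverse (fact k) * (t * l x) ^ k)))
        sums ennreal (w x * exp (- (a - t) * l x))"
      using nn t by (subst sums_ennreal) auto
    then have "ennreal (w x * exp (- (a - t) * l x)) =
        (\<Sum>k. ennreal ((w x * exp (- a * l x)) * (inverse (fact k) * (t * l x) ^ k)))"
      by (rule sums_unique)
    also have "\<dots> = (\<Sum>k. ennreal (w x * exp (- a * l x) * (l x ^ k / fact k)) * ennreal (t ^ k))"
      using nn t by (intro suminf_cong) (subst ennreal_mult[symmetric],
        auto simp: power_mult_distrib field_simps)
    finally show "ennreal (w x * exp (- (a - t) * l x)) = \<dots>" .
  qed
  also have "\<dots> = (\<Sum>k. (\<integral>\<^sup>+x. ennreal (w x * exp (- a * l x) * (l x ^ k / fact k)) * ennreal (t ^ k) \<partial>M))"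
    by (rule nn_integral_suminf) measurable
  also have "\<dots> = (\<Sum>k. (\<integral>\<^sup>+x. ennreal (w x * exp (- a * l x) * (l x ^ k / fact k)) \<partial>M) * ennreal (t ^ k))"
    by (intro suminf_cong nn_integral_multc) measurable
  finally show ?thesis .
qed

text \<open>A power series with a nonzero coefficient has at most an isolated zero at 0, so
  vanishing on a short real segment is enough.\<close>

lemma powser_coeffs_zero:
  fixes d :: "nat \<Rightarrow> complex"
  assumes eta: "eta > 0"
    and sums: "\<And>t. 0 \<le> t \<Longrightarrow> t \<le> eta \<Longrightarrow> (\<lambda>k. d k * complex_of_real t ^ k) sums 0"
  shows "d k = 0"
proof (rule ccontr)
  assume nz: "d k \<noteq> 0"
  define f where "f z = (\<Sum>k. d k * z ^ k)" for z
  have f0: "f 0 = 0" using sums[of 0] eta by (auto simp: f_def sums_iff)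
  have "d 0 = 0" using f0 by (simp add: f_def)
  then have k: "k > 0" using nz by (cases k) auto
  have "(\<lambda>k. d k * (z - 0) ^ k) sums f z" if "norm (z - 0) < eta" for z
    using powser_inside[OF sums_summable[OF sums[of eta]], of z] that eta
    by (auto simp: f_def summable_sums)
  then obtain s where s: "s > 0" "\<And>z. z \<in> cball 0 s - {0} \<Longrightarrow> f z \<noteq> 0"
    using powser_0_nonzero[of eta 0 d f k] eta f0 nz k by blast
  define t where "t = min s eta"
  have "f (complex_of_real t) = 0"
    using sums[of t] s(1) eta by (auto simp: f_def t_def sums_iff)
  moreover have "complex_of_real t \<in> cball 0 s - {0}" using s(1) eta by (auto simp: t_def)
  ultimately show False using s(2) by blast
qed

text \<open>The Taylor coefficients at \<open>a\<close> are, up to sign, moments of the nonnegative weight, so by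
  Tonelli's theorem the integral converges wherever the Taylor series does.\<close>

lemma laplace_agrees_ball:
  assumes [measurable]: "w \<in> borel_measurable M" "l \<in> borel_measurable M"
    and nn: "\<And>x. w x \<ge> 0" "\<And>x. l x \<ge> 0"
    and eta: "0 < eta" "eta < r" and F: "F holomorphic_on ball (complex_of_real a) r"
    and agr: "\<And>s. a - eta \<le> s \<Longrightarrow> s \<le> a \<Longrightarrow> laplace_agrees M w l F s"
    and t: "0 \<le> t" "t < r"
  shows "laplace_agrees M w l F (a - t)"
proof -
  define C where "C k = (\<integral>\<^sup>+x. ennreal (w x * exp (- a * l x) * (l x ^ k / fact k)) \<partial>M)" for k
  have ser: "laplace M w l (a - t) = (\<Sum>k. C k * ennreal (t ^ k))" if "t \<ge> 0" for t
    unfolding C_def by (rule laplace_power_series) (use nn that in auto)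
  \<comment> \<open>One term of a nonnegative series whose sum at \<open>t = eta\<close> is finite,
    and \<open>eta ^ k\<close> is positive.\<close>
  have fin: "C k < \<infinity>" for k
  proof -
    have "C k * ennreal (eta ^ k) \<le> (\<Sum>k. C k * ennreal (eta ^ k))"
      using sum_le_suminf[of "\<lambda>k. C k * ennreal (eta ^ k)" "{k}"] by simp
    also have "\<dots> = laplace M w l (a - eta)" using ser eta by simp
    also have "\<dots> < \<infinity>" using agr[of "a - eta"] eta by (auto simp: laplace_agrees_def)
    finally show ?thesis using eta by (auto simp: ennreal_mult_less_top)
  qed
  define c where "c k = enn2real (C k)" for k
  have c: "C k = ennreal (c k)" "c k \<ge> 0" for k using fin[of k] by (auto simp: c_def)
  have ser': "laplace M w l (a - t) = (\<Sum>k. ennreal (c k * t ^ k))" if "t \<ge> 0" for t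
    unfolding ser[OF that] c(1) using c(2) that by (simp add: ennreal_mult)
  define g where "g k = (deriv ^^ k) F (complex_of_real a) / fact k * (- 1) ^ k" for k
  have g: "(\<lambda>k. g k * complex_of_real t ^ k) sums F (complex_of_real (a - t))" if "0 \<le> t" "t < r" for t
  proof -
    have "complex_of_real (a - t) \<in> ball (complex_of_real a) r"
      using that by (auto simp: dist_norm)
    from holomorphic_power_series[OF F this]
    have "(\<lambda>k. (deriv ^^ k) F (complex_of_real a) / fact k * (- complex_of_real t) ^ k) sums F (complex_of_real (a - t))"
      by simp
    then show ?thesis by (simp add: g_def power_minus[of "complex_of_real t"] mult.assoc)
  qed
  \<comment> \<open>The moment series and the Taylor series both represent \<open>F\<close> on the
    segment from \<open>a - eta\<close> to \<open>a\<close>. Hence the Taylor series, convergent for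
    all \<open>t < r\<close>, is the moment series there too.\<close>
  have "complex_of_real (c k) - g k = 0" for k
  proof (rule powser_coeffs_zero[OF eta(1)])
    fix u :: real assume u: "0 \<le> u" "u \<le> eta"
    obtain y where y: "y \<ge> 0" "laplace M w l (a - u) = ennreal y"
        "F (complex_of_real (a - u)) = complex_of_real y"
      using agr[of "a - u"] u by (auto simp: laplace_agrees_def)
    have "(\<lambda>k. ennreal (c k * u ^ k)) sums ennreal y"
      using ser'[OF u(1)] y(2) summableI[of "\<lambda>k. ennreal (c k * u ^ k)"] by (simp add: sums_iff)
    then have "(\<lambda>k. c k * u ^ k) sums y"
      using c(2) u(1) y(1) by (subst (asm) sums_ennreal) auto
    then have "(\<lambda>k. complex_of_real (c k * u ^ k)) sums complex_of_real y" by (rule sums_of_real)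
    then have "(\<lambda>k. complex_of_real (c k * u ^ k) - g k * complex_of_real u ^ k) sums (complex_of_real y - complex_of_real y)"
      using g[of u] u eta y(3) by (intro sums_diff) auto
    then show "(\<lambda>k. (complex_of_real (c k) - g k) * complex_of_real u ^ k) sums 0"
      by (simp add: algebra_simps)
  qed
  then have cg: "g k = complex_of_real (c k)" for k by simp
  have cs: "(\<lambda>k. complex_of_real (c k * t ^ k)) sums F (complex_of_real (a - t))"
    using g[OF t] by (simp add: cg)
  have sm: "summable (\<lambda>k. c k * t ^ k)"
    using sums_summable[OF cs] by (simp only: summable_of_real_iff)
  define y where "y = (\<Sum>k. c k * t ^ k)"
  have y0: "y \<ge> 0" unfolding y_def using sm c(2) t(1) by (intro suminf_nonneg) auto
  have "(\<lambda>k. complex_of_real (c k * t ^ k)) sums complex_of_real y"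
    unfolding y_def using sm by (intro sums_of_real) (simp add: summable_sums)
  then have "F (complex_of_real (a - t)) = complex_of_real y" using cs sums_unique2 by blast
  moreover have "laplace M w l (a - t) = ennreal y"
    unfolding ser'[OF t(1)] y_def using sm c(2) t(1) by (intro suminf_ennreal2) auto
  ultimately show ?thesis using y0 unfolding laplace_agrees_def by blast
qed

text \<open>At the supremum \<open>\<sigma>\<close> of the points of failure \<open>F\<close> is
  holomorphic in a disc; expanding from a centre slightly to the right of \<open>\<sigma>\<close>
  carries agreement past \<open>\<sigma>\<close>.\<close>

lemma laplace_agrees_extend:
  assumes [measurable]: "w \<in> borel_measurable M" "l \<in> borel_measurable M"
    and nn: "\<And>x. w x \<ge> 0" "\<And>x. l x \<ge> 0"
    and F: "\<And>s. s > s0 \<Longrightarrow> \<exists>r>0. F holomorphic_on ball (complex_of_real s) r"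
    and agr: "\<And>s. s > s1 \<Longrightarrow> laplace_agrees M w l F s"
    and s: "s > s0"
  shows "laplace_agrees M w l F s"
proof (rule ccontr)
  assume bad: "\<not> laplace_agrees M w l F s"
  define B where "B = {u. u > s0 \<and> \<not> laplace_agrees M w l F u}"
  have sB: "s \<in> B" using bad s by (simp add: B_def)
  have bdd: "bdd_above B" using agr by (intro bdd_aboveI[of _ s1]) (force simp: B_def)
  define \<sigma> where "\<sigma> = Sup B"
  have "\<sigma> \<ge> s" unfolding \<sigma>_def by (rule cSup_upper[OF sB bdd])
  then have "\<sigma> > s0" using s by simp
  then obtain r where r: "r > 0" "F holomorphic_on ball (complex_of_real \<sigma>) r" using F by blast
  have above: "laplace_agrees M w l F u" if "u > \<sigma>" for u
    using that \<open>\<sigma> > s0\<close> cSup_upper[OF _ bdd, of u] by (force simp: B_def \<sigma>_def)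
  \<comment> \<open>The disc of radius \<open>3 * r / 4\<close> about \<open>a\<close> stays inside
    the given one and reaches down to \<open>\<sigma> - r / 2\<close>, while the segment of length
    \<open>r / 8\<close> to the left of \<open>a\<close> stays above
    \<open>\<sigma>\<close>.\<close>
  define a where "a = \<sigma> + r / 4"
  have "ball (complex_of_real a) (3 * r / 4) \<subseteq> ball (complex_of_real \<sigma>) r"
    using r(1) by (intro ball_subset_ball_iff[THEN iffD2]) (simp add: a_def dist_norm norm_of_real)
  then have hol: "F holomorphic_on ball (complex_of_real a) (3 * r / 4)"
    using r(2) holomorphic_on_subset by blast
  have near: "laplace_agrees M w l F (a - t)" if "0 \<le> t" "t < 3 * r / 4" for t
    by (rule laplace_agrees_ball[where eta = "r / 8" and r = "3 * r / 4"])
      (use nn r(1) hol that in \<open>auto simp: a_def intro!: above\<close>)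
  obtain u where u: "u \<in> B" "u > \<sigma> - r / 2"
    using less_cSup_iff[OF _ bdd, of "\<sigma> - r / 2"] sB r(1) unfolding \<sigma>_def by force
  have "laplace_agrees M w l F u"
    using near[of "a - u"] above[of u] u(2) by (cases "u > a") (auto simp: a_def r(1))
  then show False using u(1) by (simp add: B_def)
qed

section \<open>The zeta function on the right half-plane\<close>

text \<open>The majorant may depend on a bound \<open>K\<close> for \<open>norm s\<close>, since the
  terms of \<open>zreg\<close> grow polynomially in \<open>s\<close>.\<close>

lemma half_plane_series:
  fixes f f' :: "nat \<Rightarrow> complex \<Rightarrow> complex"
  assumes der: "\<And>n s. Re s > c \<Longrightarrow> (f n has_field_derivative f' n s) (at s)"
    and bound: "\<And>\<sigma> K. \<sigma> > c \<Longrightarrow> \<exists>h. summable h \<and>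
      (\<forall>n s. \<sigma> \<le> Re s \<longrightarrow> norm s \<le> K \<longrightarrow> norm (f n s) \<le> h n)"
    and s: "Re s > c"
  shows "summable (\<lambda>n. f n s)" "summable (\<lambda>n. f' n s)"
    and "((\<lambda>s. \<Sum>n. f n s) has_field_derivative (\<Sum>n. f' n s)) (at s)"
proof -
  have S: "open {s. Re s > c}" by (rule open_halfspace_Re_gt)
  have "\<exists>g g'. \<forall>x\<in>{s. Re s > c}. ((\<lambda>n. f n x) sums g x) \<and> ((\<lambda>n. f' n x) sums g' x)
      \<and> (g has_field_derivative g' x) (at x)"
  proof (rule series_and_derivative_comparison_complex[OF S])
    show "(f n has_field_derivative f' n x) (at x)" if "x \<in> {s. Re s > c}" for n x
      using der that by simp
    show "\<exists>d h. 0 < d \<and> summable h \<and> range h \<subseteq> \<real>\<^sub>\<ge>\<^sub>0 \<and>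
        (\<forall>\<^sub>F n in sequentially. \<forall>y\<in>ball x d \<inter> {s. Re s > c}. cmod (f n y) \<le> cmod (h n))"
      if "x \<in> {s. Re s > c}" for x
    proof -
      define d where "d = (Re x - c) / 2"
      have d: "d > 0" using that by (simp add: d_def)
      then obtain h where h: "summable h"
          "\<And>n s. Re x - d \<le> Re s \<Longrightarrow> norm s \<le> norm x + d \<Longrightarrow> norm (f n s) \<le> h n"
        using bound[of "Re x - d" "norm x + d"] by (force simp: d_def field_simps)
      have le: "norm (f n y) \<le> h n" if "y \<in> ball x d" for n y
      proof (rule h(2))
        have "norm (x - y) < d" using that by (simp add: dist_norm)
        then show "Re x - d \<le> Re y" using abs_Re_le_cmod[of "x - y"] by simp
        show "norm y \<le> norm x + d"
          using \<open>norm (x - y) < d\<close> norm_triangle_ineq2[of y x] by (simp add: norm_minus_commute)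
      qed
      have h0: "h n \<ge> 0" for n using le[of x n] d by (meson centre_in_ball norm_ge_zero order_trans)
      show ?thesis
        using d h(1) h0 le by (intro exI[of _ d] exI[of _ "\<lambda>n. complex_of_real (h n)"])
          (auto simp: summable_of_real_iff)
    qed
  qed
  then obtain g g' where g: "\<And>x. Re x > c \<Longrightarrow> (\<lambda>n. f n x) sums g x"
      "\<And>x. Re x > c \<Longrightarrow> (\<lambda>n. f' n x) sums g' x"
      "\<And>x. Re x > c \<Longrightarrow> (g has_field_derivative g' x) (at x)"
    by auto
  show "summable (\<lambda>n. f n s)" "summable (\<lambda>n. f' n s)" using g(1,2)[OF s] by (auto simp: sums_iff)
  have "((\<lambda>s. \<Sum>n. f n s) has_field_derivative g' s) (at s)"
    by (rule has_field_derivative_transform_within_open[OF g(3)[OF s] S])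
      (use s g(1) in \<open>auto simp: sums_iff\<close>)
  then show "((\<lambda>s. \<Sum>n. f n s) has_field_derivative (\<Sum>n. f' n s)) (at s)"
    using g(2)[OF s] by (simp add: sums_iff)
qed

lemma norm_of_nat_powr: "n > 0 \<Longrightarrow> norm (of_nat n powr s :: complex) = real n powr Re s"
  using norm_powr_real_powr[of "of_nat n" s] by simp

lemma of_nat_powr_of_real: "of_nat n powr complex_of_real s = complex_of_real (real n powr s)"
  using powr_of_real[of "real n" s] by simp

lemma of_nat_powr_has_field_derivative:
  assumes "n > 0" "(g has_field_derivative g') (at s)"
  shows "((\<lambda>s. of_nat n powr g s :: complex) has_field_derivative
    of_real (ln (real n)) * of_nat n powr g s * g') (at s)"
proof -
  have "((\<lambda>z. of_nat n powr z :: complex) has_field_derivative of_real (ln (real n)) * of_nat n powr g s) (at (g s))"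
    using has_field_derivative_powr_right[of "of_nat n" "g s"] assms(1) by (simp add: Ln_of_nat)
  from DERIV_chain[OF this assms(2)] show ?thesis by (simp add: o_def)
qed

lemma summable_Suc_powr: "\<sigma> > 1 \<Longrightarrow> summable (\<lambda>n. real (Suc n) powr - \<sigma>)"
  using summable_Suc_iff[of "\<lambda>n. real n powr - \<sigma>"] summable_real_powr_iff[of "-\<sigma>"] by simp

definition zeta :: "complex \<Rightarrow> complex" where
  "zeta s = (\<Sum>n. of_nat (Suc n) powr (- s))"

definition log_zeta_series :: "complex \<Rightarrow> complex" where
  "log_zeta_series s = (\<Sum>n. of_real (ln (real (Suc n))) * of_nat (Suc n) powr (- s))"

lemma zeta_series:
  assumes "Re s > 1"
  shows summable_zeta: "summable (\<lambda>n. of_nat (Suc n) powr (- s) :: complex)"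
    and summable_log_zeta_series:
      "summable (\<lambda>n. of_real (ln (real (Suc n))) * of_nat (Suc n) powr (- s) :: complex)"
    and zeta_has_field_derivative: "(zeta has_field_derivative - log_zeta_series s) (at s)"
proof -
  define f' :: "nat \<Rightarrow> complex \<Rightarrow> complex" where
    "f' n s = - (of_real (ln (real (Suc n))) * of_nat (Suc n) powr (- s))" for n s
  have der: "((\<lambda>s. of_nat (Suc n) powr (- s)) has_field_derivative f' n s) (at s)" for n s
    unfolding f'_def
    using of_nat_powr_has_field_derivative[of "Suc n" uminus "- 1" s]
    by (simp add: field_differentiable_minus DERIV_minus[OF DERIV_ident] del: of_nat_Suc)
  have bound: "\<exists>h. summable h \<and> (\<forall>n s. \<sigma> \<le> Re s \<longrightarrow> norm s \<le> K \<longrightarrow>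
      norm (of_nat (Suc n) powr (- s) :: complex) \<le> h n)" if "\<sigma> > 1" for \<sigma> K
    by (rule exI[of _ "\<lambda>n. real (Suc n) powr - \<sigma>"])
      (use that in \<open>auto simp: norm_of_nat_powr summable_Suc_powr simp del: of_nat_Suc intro!: powr_mono\<close>)
  note hp = half_plane_series[where f = "\<lambda>n s. of_nat (Suc n) powr (- s)" and c = 1, OF der bound assms]
  show "summable (\<lambda>n. of_nat (Suc n) powr (- s) :: complex)" using hp(1) by simp
  have sm: "summable (\<lambda>n. f' n s)" using hp(2) by simp
  show sm': "summable (\<lambda>n. of_real (ln (real (Suc n))) * of_nat (Suc n) powr (- s) :: complex)"
    using summable_minus[OF sm] by (simp add: f'_def)
  have "(\<Sum>n. f' n s) = - log_zeta_series s"
    unfolding f'_def log_zeta_series_def using sm' by (rule suminf_minus)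
  then show "(zeta has_field_derivative - log_zeta_series s) (at s)"
    using hp(3) by (simp add: zeta_def[abs_def])
qed

text \<open>Adding the telescoping series of \<open>n powr (1 - s)\<close> to \<open>(s - 1) * zeta s\<close> gives terms of size
  \<open>n powr (- Re s - 1)\<close>, which continues \<open>(s - 1) * zeta s\<close> to \<open>Re s > 0\<close>.\<close>

definition zreg_term :: "nat \<Rightarrow> complex \<Rightarrow> complex" where
  "zreg_term n s = (s - 1) * of_nat n powr (- s) - of_nat n powr (1 - s) + of_nat (Suc n) powr (1 - s)"

text \<open>The term is the increment over \<open>[0, 1]\<close> of
  \<open>\<phi> z = (n + z) powr (1 - s) + (s - 1) * z * n powr (- s)\<close>. The derivative of
  \<open>\<phi>\<close> is itself an increment of a power, so two mean value estimates gain a full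
  power of \<open>n\<close>.\<close>

lemma norm_zreg_term_le:
  assumes n: "n > 0" and s: "Re s > 0"
  shows "norm (zreg_term n s) \<le> norm (s - 1) * norm s * real n powr (- Re s - 1)"
proof -
  define S where "S = closed_segment (0::complex) 1"
  have S: "\<exists>t. 0 \<le> t \<and> t \<le> 1 \<and> z = complex_of_real t" if "z \<in> S" for z
    using that by (auto simp: S_def closed_segment_def scaleR_conv_of_real)
  have pos: "of_nat n + z \<notin> \<real>\<^sub>\<le>\<^sub>0" "norm z \<le> 1" if z: "z \<in> S" for z :: complex
    using S[OF z] n by (auto simp: complex_nonpos_Reals_iff)
  have inS: "0 \<in> S" "1 \<in> S" "convex S" by (auto simp: S_def)
  define B where "B = norm s * real n powr (- Re s - 1)"
  have B: "norm ((of_nat n + z) powr (- s) - of_nat n powr (- s)) \<le> B" if z: "z \<in> S" for z :: complex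
  proof -
    have "norm ((of_nat n + z) powr (- s) - (of_nat n + 0) powr (- s)) \<le> B * norm (z - 0)"
    proof (rule field_differentiable_bound[OF inS(3)])
      fix w assume w: "w \<in> S"
      show "((\<lambda>z. (of_nat n + z) powr (- s)) has_field_derivative - s * (of_nat n + w) powr (- s - 1))
          (at w within S)"
        using pos[OF w] by (auto intro!: derivative_eq_intros)
      obtain t where t: "0 \<le> t" "t \<le> 1" "w = complex_of_real t" using S[OF w] by blast
      have eq: "of_nat n + w = complex_of_real (real n + t)" using t by simp
      have "norm ((of_nat n + w) powr (- s - 1)) = (real n + t) powr (- Re s - 1)"
        unfolding eq using t(1) n by (subst norm_powr_real_powr) auto
      also have "\<dots> \<le> real n powr (- Re s - 1)"
        using n t s by (intro powr_mono2') auto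
      finally show "norm (- s * (of_nat n + w) powr (- s - 1)) \<le> B"
        unfolding B_def norm_mult by (simp add: mult_left_mono)
    qed (use z inS in auto)
    also have "\<dots> \<le> B * 1" using pos(2)[OF z] by (intro mult_left_mono) (auto simp: B_def)
    finally show ?thesis by simp
  qed
  define \<phi> where "\<phi> z = (of_nat n + z) powr (1 - s) + (s - 1) * z * of_nat n powr (- s)" for z
  have "norm (\<phi> 1 - \<phi> 0) \<le> (norm (s - 1) * B) * norm (1 - 0 :: complex)"
  proof (rule field_differentiable_bound[OF inS(3)])
    fix w assume w: "w \<in> S"
    show "(\<phi> has_field_derivative (1 - s) * ((of_nat n + w) powr (- s) - of_nat n powr (- s))) (at w within S)"
      unfolding \<phi>_def using pos[OF w] by (auto intro!: derivative_eq_intros simp: algebra_simps)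
    show "norm ((1 - s) * ((of_nat n + w) powr (- s) - of_nat n powr (- s))) \<le> norm (s - 1) * B"
      unfolding norm_mult using B[OF w] by (intro mult_mono) (auto simp: norm_minus_commute)
  qed (use inS in auto)
  moreover have "\<phi> 1 - \<phi> 0 = zreg_term n s"
    by (simp add: \<phi>_def zreg_term_def algebra_simps)
  ultimately show ?thesis by (simp add: B_def mult.assoc)
qed

text \<open>The summand 1 offsets the telescoping part, which sums to -1 for
  \<open>Re s > 1\<close>; hence this continues \<open>(s - 1) * zeta s\<close>.\<close>

definition zreg :: "complex \<Rightarrow> complex" where
  "zreg s = 1 + (\<Sum>n. zreg_term (Suc n) s)"

lemma zreg_series:
  assumes "Re s > 0"
  shows summable_zreg: "summable (\<lambda>n. zreg_term (Suc n) s)"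
    and zreg_differentiable: "zreg field_differentiable (at s)"
proof -
  have der: "(zreg_term (Suc n) has_field_derivative deriv (zreg_term (Suc n)) s) (at s)" for n s
  proof -
    have "(\<lambda>s. of_nat m powr (- s) :: complex) field_differentiable at s"
        "(\<lambda>s. of_nat m powr (1 - s) :: complex) field_differentiable at s" if "m > 0" for m
    proof -
      have "(uminus has_field_derivative - 1) (at s)" "((\<lambda>s. 1 - s) has_field_derivative - 1) (at s)"
        by (auto intro!: derivative_eq_intros)
      from this[THEN of_nat_powr_has_field_derivative[OF that]]
      show "(\<lambda>s. of_nat m powr (- s) :: complex) field_differentiable at s"
          "(\<lambda>s. of_nat m powr (1 - s) :: complex) field_differentiable at s"
        unfolding field_differentiable_def by blast+
    qed
    then show ?thesis
      unfolding zreg_term_def[abs_def] DERIV_deriv_iff_field_differentiable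
      by (intro derivative_intros) (auto simp del: of_nat_Suc)
  qed
  have bound: "\<exists>h. summable h \<and> (\<forall>n s. \<sigma> \<le> Re s \<longrightarrow> norm s \<le> K \<longrightarrow>
      norm (zreg_term (Suc n) s) \<le> h n)" if "\<sigma> > 0" for \<sigma> K
  proof (intro exI conjI allI impI)
    show "summable (\<lambda>n. (\<bar>K\<bar> + 1) * \<bar>K\<bar> * real (Suc n) powr - (\<sigma> + 1))"
      using that by (intro summable_mult summable_Suc_powr) simp
    fix n s assume s: "\<sigma> \<le> Re s" "norm s \<le> K"
    have "norm (zreg_term (Suc n) s) \<le> norm (s - 1) * norm s * real (Suc n) powr (- Re s - 1)"
      using norm_zreg_term_le[of "Suc n" s] s that by simp
    also have "\<dots> \<le> (\<bar>K\<bar> + 1) * \<bar>K\<bar> * real (Suc n) powr - (\<sigma> + 1)"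
      using s norm_triangle_ineq4[of s 1] by (intro mult_mono powr_mono) auto
    finally show "norm (zreg_term (Suc n) s) \<le> (\<bar>K\<bar> + 1) * \<bar>K\<bar> * real (Suc n) powr - (\<sigma> + 1)" .
  qed
  note hp = half_plane_series[where f = "\<lambda>n. zreg_term (Suc n)" and c = 0, OF der bound assms]
  show "summable (\<lambda>n. zreg_term (Suc n) s)" using hp(1) by simp
  show "zreg field_differentiable (at s)"
    unfolding zreg_def[abs_def]
    by (intro derivative_intros) (use hp(3) in \<open>auto simp: field_differentiable_def\<close>)
qed

lemma zreg_eq:
  assumes "Re s > 1"
  shows "zreg s = (s - 1) * zeta s"
proof -
  have "((\<lambda>n. real (Suc n) powr (1 - Re s)) \<longlongrightarrow> 0) sequentially"
    using assms by real_asymp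
  then have "((\<lambda>n. of_nat (Suc n) powr (1 - s) :: complex) \<longlongrightarrow> 0) sequentially"
    by (intro tendsto_norm_zero_cancel[of "\<lambda>n. of_nat (Suc n) powr (1 - s)"])
      (simp add: norm_of_nat_powr del: of_nat_Suc)
  from telescope_sums[OF this]
  have "(\<lambda>n. of_nat (Suc (Suc n)) powr (1 - s) - of_nat (Suc n) powr (1 - s) :: complex) sums (0 - 1)" by simp
  moreover have "(\<lambda>n. (s - 1) * of_nat (Suc n) powr (- s)) sums ((s - 1) * zeta s)"
    unfolding zeta_def using summable_zeta[OF assms] by (intro sums_mult summable_sums)
  ultimately have "(\<lambda>n. (s - 1) * of_nat (Suc n) powr (- s) +
      (of_nat (Suc (Suc n)) powr (1 - s) - of_nat (Suc n) powr (1 - s))) sums ((s - 1) * zeta s + (0 - 1))"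
    by (intro sums_add)
  then have "(\<lambda>n. zreg_term (Suc n) s) sums ((s - 1) * zeta s - 1)"
    by (simp add: zreg_term_def algebra_simps)
  then show ?thesis by (simp add: zreg_def sums_iff)
qed

definition zreg_term_real :: "nat \<Rightarrow> real \<Rightarrow> real" where
  "zreg_term_real n s = (s - 1) * real n powr (- s) - real n powr (1 - s) + real (Suc n) powr (1 - s)"

lemma zreg_term_of_real: "zreg_term n (complex_of_real s) = complex_of_real (zreg_term_real n s)"
  using of_nat_powr_of_real[of _ "- s"] of_nat_powr_of_real[of _ "1 - s"]
  by (simp add: zreg_term_def zreg_term_real_def del: of_nat_Suc)

text \<open>By the mean value theorem each term is
  \<open>(s - 1) * (n powr (- s) - x powr (- s))\<close> with \<open>n < x < n + 1\<close>. For
  \<open>s >= 1\<close> it is nonnegative; for \<open>s < 1\<close> a telescoping lower bound gives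
  \<open>y >= 1 - (1 - s) = s\<close>.\<close>

lemma zreg_of_real:
  assumes s: "s > 0"
  obtains y where "y > 0" "zreg (complex_of_real s) = complex_of_real y"
proof -
  have sm: "summable (\<lambda>n. zreg_term_real (Suc n) s)"
    using summable_zreg[of "complex_of_real s"] s by (simp add: zreg_term_of_real summable_of_real_iff)
  define y where "y = 1 + (\<Sum>n. zreg_term_real (Suc n) s)"
  have eq: "zreg (complex_of_real s) = complex_of_real y"
    using sm by (simp add: zreg_def y_def zreg_term_of_real suminf_of_real)
  have mvt: "\<exists>x. real n < x \<and> x < real (Suc n) \<and>
      zreg_term_real n s = (s - 1) * (real n powr (- s) - x powr (- s))" if "n > 0" for n
  proof -
    have "\<exists>z>real n. z < real (Suc n) \<and>
      real (Suc n) powr (1 - s) - real n powr (1 - s) = (real (Suc n) - real n) * ((1 - s) * z powr (- s))"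
      by (rule MVT2) (use that in \<open>auto intro!: derivative_eq_intros\<close>)
    then show ?thesis by (auto simp: zreg_term_real_def algebra_simps)
  qed
  have "y > 0"
  proof (cases "s \<ge> 1")
    case True
    have "zreg_term_real (Suc n) s \<ge> 0" for n
    proof -
      obtain x where x: "real (Suc n) < x" "zreg_term_real (Suc n) s = (s - 1) * (real (Suc n) powr (- s) - x powr (- s))"
        using mvt[of "Suc n"] by auto
      have "x powr (- s) \<le> real (Suc n) powr (- s)" using x(1) s by (intro powr_mono2') auto
      then show ?thesis using x(2) True by simp
    qed
    then have "(\<Sum>n. zreg_term_real (Suc n) s) \<ge> 0" using sm by (intro suminf_nonneg)
    then show ?thesis by (simp add: y_def)
  next
    case False
    have "((\<lambda>n. real (Suc n) powr (- s)) \<longlongrightarrow> 0) sequentially" using s by real_asymp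
    from telescope_sums[OF this]
    have tele: "(\<lambda>n. real (Suc (Suc n)) powr (- s) - real (Suc n) powr (- s)) sums (- 1)" by simp
    have "zreg_term_real (Suc n) s \<ge> (1 - s) * (real (Suc (Suc n)) powr (- s) - real (Suc n) powr (- s))" for n
    proof -
      obtain x where x: "real (Suc n) < x" "x < real (Suc (Suc n))"
          "zreg_term_real (Suc n) s = (s - 1) * (real (Suc n) powr (- s) - x powr (- s))"
        using mvt[of "Suc n"] by auto
      have "real (Suc (Suc n)) powr (- s) \<le> x powr (- s)" using x(1,2) s by (intro powr_mono2') auto
      then have "(1 - s) * (real (Suc (Suc n)) powr (- s) - real (Suc n) powr (- s))
          \<le> (1 - s) * (x powr (- s) - real (Suc n) powr (- s))"
        using False by (intro mult_left_mono) auto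
      then show ?thesis using x(3) by (simp add: algebra_simps)
    qed
    from sums_le[OF this sums_mult[OF tele] summable_sums[OF sm]]
    have "(\<Sum>n. zreg_term_real (Suc n) s) \<ge> (1 - s) * (- 1)" .
    then show ?thesis using s by (simp add: y_def)
  qed
  then show ?thesis using that eq by blast
qed

section \<open>Dirichlet series over the primes\<close>

definition prime_ln :: "nat \<Rightarrow> real" where
  "prime_ln n = (if prime n then ln (real n) else 0)"

lemma prime_ln_nonneg [simp]: "prime_ln n \<ge> 0"
  using prime_ge_1_nat[of n] by (auto simp: prime_ln_def)

lemma summable_prime_ln_powr:
  assumes "\<sigma> > 1"
  shows "summable (\<lambda>n. prime_ln n * real n powr - \<sigma>)"
proof (rule summable_comparison_test')
  \<comment> \<open>Half the excess of \<open>\<sigma>\<close> over 1: bounding \<open>ln n\<close>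
    by \<open>n powr a / a\<close> leaves an exponent below -1.\<close>
  define a where "a = (\<sigma> - 1) / 2"
  have a: "a > 0" using assms by (simp add: a_def)
  show "summable (\<lambda>n. (1 / a) * real n powr (a - \<sigma>))"
    using assms by (intro summable_mult) (simp add: summable_real_powr_iff a_def field_simps)
  show "norm (prime_ln n * real n powr - \<sigma>) \<le> (1 / a) * real n powr (a - \<sigma>)" if "n \<ge> 0" for n
  proof (cases "prime n")
    case True
    then have n: "real n \<ge> 1" using prime_ge_1_nat[of n] by simp
    have "prime_ln n * real n powr - \<sigma> \<le> (real n powr a / a) * real n powr - \<sigma>"
      using True ln_powr_bound[OF n a] by (intro mult_right_mono) (auto simp: prime_ln_def)
    also have "\<dots> = (1 / a) * real n powr (a - \<sigma>)" by (simp add: powr_diff powr_minus divide_inverse)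
    finally show ?thesis by simp
  qed (use a in \<open>auto simp: prime_ln_def\<close>)
qed

definition prime_series :: "complex \<Rightarrow> complex" where
  "prime_series s = (\<Sum>n. of_real (prime_ln n) * of_nat n powr (- s))"

text \<open>The prime powers with exponent at least 3: with \<open>x = n powr s\<close>,
  \<open>1 / (x - 1) = 1 / x + 1 / x^2 + 1 / (x^2 * (x - 1))\<close>, and this is the last
  summand.\<close>

definition prime_tail_term :: "nat \<Rightarrow> complex \<Rightarrow> complex" where
  "prime_tail_term n s = of_real (prime_ln n) * (of_nat n powr (- (2 * s)) / (of_nat n powr s - 1))"

definition prime_tail :: "complex \<Rightarrow> complex" where
  "prime_tail s = (\<Sum>n. prime_tail_term n s)"

lemma of_nat_powr_field_differentiable:
  assumes "n > 0"
  shows "(\<lambda>s. of_nat n powr (c * s) :: complex) field_differentiable at s"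
proof -
  have "((\<lambda>s. c * s) has_field_derivative c) (at s)"
    by (auto intro!: derivative_eq_intros)
  from of_nat_powr_has_field_derivative[OF assms this] show ?thesis
    unfolding field_differentiable_def by blast
qed

lemma prime_series_field_differentiable:
  assumes "Re s > 1"
  shows "prime_series field_differentiable (at s)"
proof -
  define f :: "nat \<Rightarrow> complex \<Rightarrow> complex" where "f n s = of_real (prime_ln n) * of_nat n powr (- s)" for n s
  have der: "(f n has_field_derivative deriv (f n) s) (at s)" for n s
    unfolding DERIV_deriv_iff_field_differentiable f_def
    using of_nat_powr_field_differentiable[of n "- 1" s]
    by (cases "n = 0") (auto intro!: derivative_intros)
  have bound: "\<exists>h. summable h \<and> (\<forall>n s. \<sigma> \<le> Re s \<longrightarrow> norm s \<le> K \<longrightarrow> norm (f n s) \<le> h n)"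
    if "\<sigma> > 1" for \<sigma> K
  proof (intro exI conjI allI impI)
    show "summable (\<lambda>n. prime_ln n * real n powr - \<sigma>)" using that by (rule summable_prime_ln_powr)
    show "norm (f n s) \<le> prime_ln n * real n powr - \<sigma>" if "\<sigma> \<le> Re s" for n s
      using that by (cases "n = 0") (auto simp: f_def norm_mult norm_of_nat_powr intro!: mult_left_mono powr_mono)
  qed
  from half_plane_series(3)[OF der bound assms]
  show ?thesis unfolding prime_series_def[abs_def] f_def field_differentiable_def by blast
qed

text \<open>As \<open>n >= 2\<close>, the denominator is at least a fixed multiple of
  \<open>n powr Re s\<close>. The terms are then of order
  \<open>ln n * n powr (- 3 * \<sigma>)\<close>, which explains the abscissa
  \<open>1 / 3\<close>.\<close>

lemma prime_tail_series:
  assumes "Re s > 1 / 3"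
  shows summable_prime_tail: "summable (\<lambda>n. prime_tail_term n s)"
    and prime_tail_field_differentiable: "prime_tail field_differentiable (at s)"
proof -
  have lower: "norm (of_nat n powr s - 1 :: complex) \<ge> real n powr Re s * (1 - 2 powr - \<sigma>)"
    if "\<sigma> > 0" "\<sigma> \<le> Re s" "prime n" for n s \<sigma>
  proof -
    have n: "real n \<ge> 2" using prime_ge_2_nat[OF that(3)] by simp
    have "1 = real n powr Re s * real n powr - Re s" using n by (simp add: powr_minus)
    also have "\<dots> \<le> real n powr Re s * 2 powr - Re s"
      using n that by (intro mult_left_mono powr_mono2') auto
    also have "\<dots> \<le> real n powr Re s * 2 powr - \<sigma>"
      using that by (intro mult_left_mono powr_mono) auto
    finally have "real n powr Re s * (1 - 2 powr - \<sigma>) \<le> real n powr Re s - 1"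
      by (simp add: algebra_simps)
    also have "\<dots> = norm (of_nat n powr s :: complex) - norm (1 :: complex)"
      using n by (simp add: norm_of_nat_powr)
    also have "\<dots> \<le> norm (of_nat n powr s - 1 :: complex)" by (rule norm_triangle_ineq2)
    finally show ?thesis .
  qed
  have pos: "1 - 2 powr - \<sigma> > 0" if "\<sigma> > 0" for \<sigma> :: real
    using that powr_less_mono[of "- \<sigma>" 0 2] by simp
  have nz: "of_nat n powr s - 1 \<noteq> (0 :: complex)" if "Re s > 0" "prime n" for n s
  proof -
    have "real n powr Re s * (1 - 2 powr - Re s) > 0"
      using pos[OF that(1)] prime_gt_0_nat[OF that(2)] by simp
    then show ?thesis using lower[of "Re s" s n] that by auto
  qed
  have der: "(prime_tail_term n has_field_derivative deriv (prime_tail_term n) s) (at s)"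
    if "Re s > 1 / 3" for n s
  proof (cases "prime n")
    case True
    have n0: "n > 0" using True by (rule prime_gt_0_nat)
    have "Re s > 0" using that by simp
    with True show ?thesis
      unfolding DERIV_deriv_iff_field_differentiable prime_tail_term_def[abs_def]
      using of_nat_powr_field_differentiable[OF n0, of "- 2" s]
        of_nat_powr_field_differentiable[OF n0, of 1 s] nz[of s n]
      by (intro derivative_intros) auto
  next
    case False
    then have "prime_tail_term n = (\<lambda>s. 0)" by (simp add: fun_eq_iff prime_tail_term_def prime_ln_def)
    then show ?thesis by simp
  qed
  have bound: "\<exists>h. summable h \<and> (\<forall>n s. \<sigma> \<le> Re s \<longrightarrow> norm s \<le> K \<longrightarrow> norm (prime_tail_term n s) \<le> h n)"
    if \<sigma>: "\<sigma> > 1 / 3" for \<sigma> K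
  proof (intro exI conjI allI impI)
    have \<sigma>0: "\<sigma> > 0" using \<sigma> by simp
    show "summable (\<lambda>n. prime_ln n * real n powr - (3 * \<sigma>) / (1 - 2 powr - \<sigma>))"
      using \<sigma> by (intro summable_divide summable_prime_ln_powr) simp
    show "norm (prime_tail_term n s) \<le> prime_ln n * real n powr - (3 * \<sigma>) / (1 - 2 powr - \<sigma>)"
      if "\<sigma> \<le> Re s" for n s
    proof (cases "prime n")
      case True
      have n: "real n \<ge> 1" using prime_ge_1_nat[OF True] by simp
      have "norm (prime_tail_term n s) = prime_ln n * (real n powr - (2 * Re s) / norm (of_nat n powr s - 1 :: complex))"
        using n by (simp add: prime_tail_term_def norm_mult norm_divide norm_of_nat_powr)
      also have "\<dots> \<le> prime_ln n * (real n powr - (2 * Re s) / (real n powr Re s * (1 - 2 powr - \<sigma>)))"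
      proof -
        have "real n powr Re s * (1 - 2 powr - \<sigma>) > 0" using pos[OF \<sigma>0] n by simp
        then show ?thesis
          by (intro mult_left_mono frac_le lower[OF \<sigma>0 that True]) auto
      qed
      also have "\<dots> = prime_ln n * real n powr - (3 * Re s) / (1 - 2 powr - \<sigma>)"
      proof -
        have "real n powr - (3 * Re s) = real n powr - (2 * Re s) / real n powr Re s"
          using powr_diff[of "real n" "- (2 * Re s)" "Re s"] by simp
        then show ?thesis by simp
      qed
      also have "\<dots> \<le> prime_ln n * real n powr - (3 * \<sigma>) / (1 - 2 powr - \<sigma>)"
        using pos[OF \<sigma>0] that n by (intro divide_right_mono mult_left_mono powr_mono) auto
      finally show ?thesis .
    qed (use pos[OF \<sigma>0] in \<open>simp add: prime_tail_term_def prime_ln_def\<close>)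
  qed
  note hp = half_plane_series[where f = prime_tail_term and c = "1 / 3", OF der bound assms]
  show "summable (\<lambda>n. prime_tail_term n s)" using hp(1) by simp
  show "prime_tail field_differentiable (at s)"
    unfolding prime_tail_def[abs_def] field_differentiable_def using hp(3) by blast
qed

section \<open>Logarithmic derivative of zeta as a series over primes\<close>

lemma ennreal_suminf_swap:
  fixes f :: "nat \<Rightarrow> nat \<Rightarrow> ennreal"
  shows "(\<Sum>n. \<Sum>k. f n k) = (\<Sum>k. \<Sum>n. f n k)"
  using nn_integral_suminf[of "\<lambda>k n. f n k" "count_space UNIV"] by (simp add: nn_integral_count_space_nat)

text \<open>The identity behind the von Mangoldt function: exactly \<open>multiplicity p n\<close>
  of the powers \<open>p ^ Suc k\<close> divide \<open>n\<close>. The indicator form allows the sum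
  over \<open>n\<close> to be moved inside.\<close>

lemma ln_eq_suminf_prime_powers:
  assumes "n > 0"
  shows "ennreal (ln (real n)) = (\<Sum>p. \<Sum>k. if p ^ Suc k dvd n then ennreal (prime_ln p) else 0)"
proof -
  have inner: "(\<Sum>k. if p ^ Suc k dvd n then ennreal (prime_ln p) else 0) =
      ennreal (real (multiplicity p n) * prime_ln p)" for p
  proof (cases "prime p")
    case True
    have dvd: "p ^ Suc k dvd n \<longleftrightarrow> k < multiplicity p n" for k
      using assms True by (subst power_dvd_iff_le_multiplicity) (auto simp: Suc_le_eq prime_gt_Suc_0_nat)
    have "(\<Sum>k. if p ^ Suc k dvd n then ennreal (prime_ln p) else 0) =
        (\<Sum>k<multiplicity p n. if p ^ Suc k dvd n then ennreal (prime_ln p) else 0)"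
      by (rule suminf_finite) (auto simp: dvd simp del: power_Suc)
    also have "\<dots> = (\<Sum>k<multiplicity p n. ennreal (prime_ln p))"
      by (rule sum.cong) (auto simp: dvd simp del: power_Suc)
    finally show ?thesis by (simp add: ennreal_mult ennreal_of_nat_eq_real_of_nat)
  next
    case False
    then show ?thesis by (simp add: prime_ln_def cong: if_cong)
  qed
  have "real n = real (\<Prod>p\<in>prime_factors n. p ^ multiplicity p n)"
    using prime_factorization_nat[OF assms] by (rule arg_cong)
  then have "ln (real n) = ln (\<Prod>p\<in>prime_factors n. real p ^ multiplicity p n)"
    by (simp only: of_nat_prod of_nat_power)
  also have "\<dots> = (\<Sum>p\<in>prime_factors n. ln (real p ^ multiplicity p n))"
    by (rule ln_prod) (auto intro: prime_gt_0_nat)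
  also have "\<dots> = (\<Sum>p\<in>prime_factors n. real (multiplicity p n) * prime_ln p)"
    by (rule sum.cong) (auto simp: ln_realpow prime_gt_0_nat prime_ln_def in_prime_factors_iff)
  finally have "ennreal (ln (real n)) = (\<Sum>p\<in>prime_factors n. ennreal (real (multiplicity p n) * prime_ln p))"
    by (simp add: sum_ennreal)
  also have "\<dots> = (\<Sum>p. ennreal (real (multiplicity p n) * prime_ln p))"
    by (rule suminf_finite[symmetric])
      (auto simp: prime_ln_def in_prime_factors_iff not_dvd_imp_multiplicity_0 assms)
  finally show ?thesis by (simp only: inner)
qed

context
  fixes s :: real
  assumes s: "s > 1"
begin

lemma summable_nat_powr: "summable (\<lambda>n. real n powr - s)"
  using s by (simp add: summable_real_powr_iff)

lemma suminf_multiples_powr: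
  assumes "d > 0"
  shows "(\<Sum>n. if d dvd n then ennreal (real n powr - s) else 0) =
    ennreal (real d powr - s) * ennreal (\<Sum>n. real n powr - s)"
proof -
  have "(\<lambda>m. real (d * m) powr - s) sums (real d powr - s * (\<Sum>n. real n powr - s))"
    unfolding of_nat_mult using summable_nat_powr by (simp add: powr_mult sums_mult summable_sums)
  then have "(\<lambda>m. ennreal (real (d * m) powr - s)) sums ennreal (real d powr - s * (\<Sum>n. real n powr - s))"
    using summable_nat_powr by (subst sums_ennreal) (auto intro!: mult_nonneg_nonneg suminf_nonneg)
  then have "(\<lambda>m. if d dvd d * m then ennreal (real (d * m) powr - s) else 0) sums
      ennreal (real d powr - s * (\<Sum>n. real n powr - s))" by simp
  then have "(\<lambda>n. if d dvd n then ennreal (real n powr - s) else 0) sums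
      ennreal (real d powr - s * (\<Sum>n. real n powr - s))"
    using assms by (subst (asm) sums_mono_reindex[where g = "\<lambda>m. d * m"]) (auto simp: strict_mono_def)
  then show ?thesis by (simp add: sums_iff ennreal_mult')
qed

lemma suminf_prime_powers:
  assumes "prime p"
  shows "(\<Sum>k. ennreal (real (p ^ Suc k) powr - s)) = ennreal (1 / (real p powr s - 1))"
proof -
  have p: "real p > 1" using prime_gt_1_nat[OF assms] by simp
  have ps: "real p powr s > 1" using p s by simp
  have q: "real p powr - s > 0" "real p powr - s < 1"
    using p ps by (auto simp: powr_minus field_simps)
  have "(\<lambda>k. real p powr - s * (real p powr - s) ^ k) sums (real p powr - s * (1 / (1 - real p powr - s)))"
    using q by (intro sums_mult geometric_sums) simp
  also have "real p powr - s * (1 / (1 - real p powr - s)) = 1 / (real p powr s - 1)"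
    using p ps by (simp add: powr_minus field_simps)
  also have "(\<lambda>k. real p powr - s * (real p powr - s) ^ k) = (\<lambda>k. real (p ^ Suc k) powr - s)"
    using p by (auto simp: fun_eq_iff powr_mult powr_power[symmetric] powr_realpow[symmetric] powr_powr mult.commute)
  finally have "(\<lambda>k. ennreal (real (p ^ Suc k) powr - s)) sums ennreal (1 / (real p powr s - 1))"
    using ps by (subst sums_ennreal) auto
  then show ?thesis by (simp add: sums_iff)
qed

text \<open>Insert the expansion of \<open>ln n\<close> over prime powers and sum over
  \<open>n\<close> first: the multiples of \<open>p ^ Suc k\<close> contribute
  \<open>(p ^ Suc k) powr (- s)\<close> times the zeta series, and a geometric series in
  \<open>k\<close> remains. In \<open>ennreal\<close> the exchanges are free.\<close>

lemma ln_series_eq: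
  "(\<Sum>n. ennreal (ln (real n) * real n powr - s)) =
    (\<Sum>p. ennreal (prime_ln p / (real p powr s - 1))) * ennreal (\<Sum>n. real n powr - s)"
proof -
  define f where "f n p k = (if p ^ Suc k dvd n then ennreal (prime_ln p) else 0) * ennreal (real n powr - s)"
    for n p k
  define z where "z = (\<Sum>n. real n powr - s)"
  have "(\<Sum>n. ennreal (ln (real n) * real n powr - s)) = (\<Sum>n. \<Sum>p. \<Sum>k. f n p k)"
  proof (rule suminf_cong)
    fix n
    show "ennreal (ln (real n) * real n powr - s) = (\<Sum>p. \<Sum>k. f n p k)"
    proof (cases "n = 0")
      case False
      then have "ennreal (ln (real n) * real n powr - s) = ennreal (ln (real n)) * ennreal (real n powr - s)"
        by (intro ennreal_mult) auto
      then show ?thesis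
        using False by (simp add: ln_eq_suminf_prime_powers f_def ennreal_suminf_multc)
    qed (simp add: f_def)
  qed
  also have "\<dots> = (\<Sum>p. \<Sum>n. \<Sum>k. f n p k)" by (rule ennreal_suminf_swap)
  also have "\<dots> = (\<Sum>p. \<Sum>k. \<Sum>n. f n p k)" by (intro suminf_cong ennreal_suminf_swap)
  also have "\<dots> = (\<Sum>p. ennreal (prime_ln p / (real p powr s - 1)) * ennreal z)"
  proof (rule suminf_cong)
    fix p
    show "(\<Sum>k. \<Sum>n. f n p k) = ennreal (prime_ln p / (real p powr s - 1)) * ennreal z"
    proof (cases "prime p")
      case True
      have "(\<Sum>n. f n p k) = ennreal (prime_ln p) * (ennreal (real (p ^ Suc k) powr - s) * ennreal z)" for k
      proof -
        have "(\<Sum>n. f n p k) = (\<Sum>n. ennreal (prime_ln p) * (if p ^ Suc k dvd n then ennreal (real n powr - s) else 0))"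
          by (rule suminf_cong) (auto simp: f_def)
        also have "\<dots> = ennreal (prime_ln p) * (\<Sum>n. if p ^ Suc k dvd n then ennreal (real n powr - s) else 0)"
          by (rule ennreal_suminf_cmult)
        also have "(\<Sum>n. if p ^ Suc k dvd n then ennreal (real n powr - s) else 0) =
            ennreal (real (p ^ Suc k) powr - s) * ennreal z"
          unfolding z_def by (rule suminf_multiples_powr) (use True prime_gt_0_nat in auto)
        finally show ?thesis .
      qed
      then have "(\<Sum>k. \<Sum>n. f n p k) =
          ennreal (prime_ln p) * ((\<Sum>k. ennreal (real (p ^ Suc k) powr - s)) * ennreal z)"
        by (simp add: ennreal_suminf_cmult ennreal_suminf_multc del: power_Suc)
      also have "\<dots> = ennreal (prime_ln p / (real p powr s - 1)) * ennreal z"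
      proof -
        have "real p powr s \<ge> 1" using s prime_ge_1_nat[OF True] by (simp add: ge_one_powr_ge_zero)
        then have "ennreal (prime_ln p / (real p powr s - 1)) = ennreal (prime_ln p) * ennreal (1 / (real p powr s - 1))"
          by (subst ennreal_mult[symmetric]) auto
        then show ?thesis unfolding suminf_prime_powers[OF True] by (simp add: mult.assoc)
      qed
      finally show ?thesis .
    qed (simp add: f_def prime_ln_def cong: if_cong)
  qed
  also have "\<dots> = (\<Sum>p. ennreal (prime_ln p / (real p powr s - 1))) * ennreal z"
    by (rule ennreal_suminf_multc)
  finally show ?thesis by (simp only: z_def)
qed

end

definition prime_series_real :: "real \<Rightarrow> real" where
  "prime_series_real s = (\<Sum>n. prime_ln n * real n powr - s)"

lemma prime_series_of_real:
  assumes "s > 1"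
  shows "prime_series (complex_of_real s) = complex_of_real (prime_series_real s)"
  using summable_prime_ln_powr[OF assms] of_nat_powr_of_real[of _ "- s"]
  by (simp add: prime_series_def prime_series_real_def suminf_of_real)

definition prime_tail_term_real :: "nat \<Rightarrow> real \<Rightarrow> real" where
  "prime_tail_term_real n s = prime_ln n * (real n powr - (2 * s) / (real n powr s - 1))"

lemma prime_tail_term_of_real:
  "prime_tail_term n (complex_of_real s) = complex_of_real (prime_tail_term_real n s)"
  using of_nat_powr_of_real[of n s] of_nat_powr_of_real[of n "- (2 * s)"]
  by (simp add: prime_tail_term_def prime_tail_term_real_def)

lemma zreg_holomorphic: "zreg holomorphic_on {s. Re s > 0}"
  using zreg_differentiable field_differentiable_at_within
  by (auto simp: holomorphic_on_def)

text \<open>The factor \<open>s - 1\<close> contributes the pole term, and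
  \<open>- zeta' / zeta\<close> is the sum of \<open>ln p / (p powr s - 1)\<close>, split into first
  powers, squares and higher powers.\<close>

lemma log_deriv_zreg:
  assumes s: "s > 1"
  shows "deriv zreg (complex_of_real s) / zreg (complex_of_real s) =
    1 / (complex_of_real s - 1) - prime_series (complex_of_real s)
      - prime_series (complex_of_real (2 * s)) - prime_tail (complex_of_real s)"
proof -
  define Z where "Z = (\<Sum>n. real n powr - s)"
  define L where "L = (\<Sum>n. ln (real n) * real n powr - s)"
  define q where "q p = prime_ln p / (real p powr s - 1)" for p
  have Z: "zeta (complex_of_real s) = complex_of_real Z"
  proof -
    have "zeta (complex_of_real s) = (\<Sum>n. complex_of_real (real (Suc n) powr - s))"
      unfolding zeta_def using of_nat_powr_of_real[of _ "- s"] by (simp del: of_nat_Suc)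
    also have "\<dots> = complex_of_real (\<Sum>n. real (Suc n) powr - s)"
      using summable_Suc_powr[OF s] by (simp only: suminf_of_real)
    also have "(\<Sum>n. real (Suc n) powr - s) = Z"
      unfolding Z_def using suminf_split_head[OF summable_nat_powr[OF s]] by simp
    finally show ?thesis .
  qed
  have sL: "summable (\<lambda>n. ln (real (Suc n)) * real (Suc n) powr - s)"
  proof -
    have "summable (\<lambda>n. complex_of_real (ln (real (Suc n)) * real (Suc n) powr - s))"
      using summable_log_zeta_series[of "complex_of_real s"] s of_nat_powr_of_real[of _ "- s"]
      by (simp del: of_nat_Suc)
    then show ?thesis by (simp only: summable_of_real_iff)
  qed
  have sL': "summable (\<lambda>n. ln (real n) * real n powr - s)"
    using sL summable_Suc_iff[of "\<lambda>n. ln (real n) * real n powr - s"] by simp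
  have L: "log_zeta_series (complex_of_real s) = complex_of_real L"
  proof -
    have "log_zeta_series (complex_of_real s) = (\<Sum>n. complex_of_real (ln (real (Suc n)) * real (Suc n) powr - s))"
      unfolding log_zeta_series_def using of_nat_powr_of_real[of _ "- s"] by (simp del: of_nat_Suc)
    also have "\<dots> = complex_of_real (\<Sum>n. ln (real (Suc n)) * real (Suc n) powr - s)"
      using sL by (simp only: suminf_of_real)
    also have "(\<Sum>n. ln (real (Suc n)) * real (Suc n) powr - s) = L"
      unfolding L_def using suminf_split_head[OF sL'] by simp
    finally show ?thesis .
  qed
  have sT: "summable (\<lambda>n. prime_tail_term_real n s)"
    using summable_prime_tail[of "complex_of_real s"] s
    by (simp add: prime_tail_term_of_real summable_of_real_iff)
  have q_eq: "q n = prime_ln n * real n powr - s + prime_ln n * real n powr - (2 * s) + prime_tail_term_real n s" for n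
  proof (cases "prime n")
    case True
    then have n: "real n > 1" using prime_gt_1_nat[of n] by simp
    define x where "x = real n powr s"
    have x: "x > 1" using n s by (simp add: x_def)
    have e: "real n powr - s = 1 / x" "real n powr - (2 * s) = 1 / x ^ 2"
      using n by (auto simp: x_def powr_minus divide_inverse powr_power mult.commute)
    have "1 / (x - 1) = 1 / x + 1 / x ^ 2 + (1 / x ^ 2) / (x - 1)"
      using x by (simp add: field_simps power2_eq_square)
    then show ?thesis unfolding q_def prime_tail_term_real_def e x_def[symmetric]
      by (metis (no_types, opaque_lifting) distrib_left mult_1_right times_divide_eq_right)
  qed (simp add: q_def prime_ln_def prime_tail_term_real_def)
  have s2: "2 * s > 1" using s by simp
  have sq: "q sums (prime_series_real s + prime_series_real (2 * s) + (\<Sum>n. prime_tail_term_real n s))"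
    unfolding q_eq[abs_def] prime_series_real_def
    by (intro sums_add summable_sums summable_prime_ln_powr s s2 sT)
  have q0: "q n \<ge> 0" for n
  proof (cases "prime n")
    case True
    then have "real n powr s \<ge> 1" using s prime_ge_1_nat[OF True] by (simp add: ge_one_powr_ge_zero)
    then show ?thesis by (simp add: q_def)
  qed (simp add: q_def prime_ln_def)
  have Z0: "Z > 0"
  proof -
    have "Z \<ge> sum (\<lambda>n. real n powr - s) {1}"
      unfolding Z_def by (rule sum_le_suminf[OF summable_nat_powr[OF s]]) auto
    then show ?thesis by simp
  qed
  have LQ: "L = suminf q * Z"
  proof -
    have ln0: "ln (real n) * real n powr - s \<ge> 0" for n by (cases "n = 0") auto
    have "ennreal L = (\<Sum>n. ennreal (ln (real n) * real n powr - s))"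
      unfolding L_def by (rule suminf_ennreal2[OF ln0 sL', symmetric])
    also have "\<dots> = (\<Sum>p. ennreal (q p)) * ennreal Z"
      unfolding q_def Z_def by (rule ln_series_eq[OF s])
    also have "(\<Sum>p. ennreal (q p)) = ennreal (suminf q)"
      by (rule suminf_ennreal2[OF q0 sums_summable[OF sq]])
    also have "ennreal (suminf q) * ennreal Z = ennreal (suminf q * Z)"
      using Z0 suminf_nonneg[OF sums_summable[OF sq] q0] by (simp add: ennreal_mult)
    finally show ?thesis
      using suminf_nonneg[OF sL' ln0] suminf_nonneg[OF sums_summable[OF sq] q0] Z0 by (simp add: L_def)
  qed
  define S where "S = complex_of_real s"
  have S: "Re S > 1" using s by (simp add: S_def)
  have "((\<lambda>s. (s - 1) * zeta s) has_field_derivative (zeta S + (S - 1) * (- log_zeta_series S))) (at S)"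
    by (auto intro!: derivative_eq_intros zeta_has_field_derivative[OF S])
  then have "(zreg has_field_derivative (zeta S + (S - 1) * (- log_zeta_series S))) (at S)"
    by (rule has_field_derivative_transform_within_open[OF _ open_halfspace_Re_gt[of 1]])
      (use S in \<open>auto simp: zreg_eq\<close>)
  then have "deriv zreg S = zeta S - (S - 1) * log_zeta_series S"
    by (simp add: DERIV_imp_deriv)
  moreover have "zeta S \<noteq> 0" "S \<noteq> 1" using Z Z0 S by (auto simp: S_def)
  ultimately have "deriv zreg S / zreg S = 1 / (S - 1) - log_zeta_series S / zeta S"
    unfolding zreg_eq[OF S] by (simp add: divide_simps)
  also have "log_zeta_series S / zeta S = complex_of_real (suminf q)"
    using Z0 by (simp add: S_def L Z LQ)
  also have "\<dots> = prime_series (complex_of_real s) + prime_series (complex_of_real (2 * s)) + prime_tail (complex_of_real s)"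
    using arg_cong[OF sums_unique[OF sq], of complex_of_real] suminf_of_real[OF sT, where 'a = complex]
    unfolding prime_series_of_real[OF s] prime_series_of_real[OF s2] prime_tail_def prime_tail_term_of_real
    by simp
  finally show ?thesis by (simp add: S_def)
qed

section \<open>Mellin transforms of the two Chebyshev terms\<close>

lemma nn_integral_powr_atLeast:
  assumes "a > 0" "s > 0"
  shows "(\<integral>\<^sup>+x. ennreal (x powr (- s - 1)) * indicator {a..} x \<partial>lborel) = ennreal (a powr - s / s)"
proof -
  have "(\<integral>\<^sup>+x. ennreal (x powr (- s - 1)) * indicator {a..} x \<partial>lborel) = ennreal (0 - (- (a powr - s / s)))"
  proof (rule nn_integral_FTC_atLeast)
    show "((\<lambda>x. - (x powr - s / s)) has_real_derivative x powr (- s - 1)) (at x)" if "a \<le> x" for x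
      using that assms by (auto intro!: derivative_eq_intros)
    have "((\<lambda>x. - (x powr - s / s)) \<longlongrightarrow> 0) at_top" using assms(2) by real_asymp
    then show "((\<lambda>x. - (x powr - s / s)) \<longlongrightarrow> 0) at_top" .
  qed (use assms in auto)
  then show ?thesis by simp
qed

text \<open>A jump of height \<open>c n\<close> at \<open>a n\<close> contributes
  \<open>c n * a n powr (- s) / s\<close>. Positivity of \<open>a n\<close> is asked only where
  \<open>c n\<close> is nonzero, since index 0 has \<open>a 0 = 0\<close> in both
  applications.\<close>

lemma nn_integral_step_powr:
  fixes c a :: "nat \<Rightarrow> real"
  assumes s: "s > 0" and c: "\<And>n. c n \<ge> 0" and a: "\<And>n. c n \<noteq> 0 \<Longrightarrow> a n > 0"
  shows "(\<integral>\<^sup>+x. (\<Sum>n. ennreal (c n) * indicator {a n..} x) * ennreal (x powr (- s - 1)) \<partial>lborel) =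
    (\<Sum>n. ennreal (c n * a n powr - s / s))"
proof -
  have "(\<integral>\<^sup>+x. (\<Sum>n. ennreal (c n) * indicator {a n..} x) * ennreal (x powr (- s - 1)) \<partial>lborel) =
      (\<integral>\<^sup>+x. (\<Sum>n. ennreal (c n) * (ennreal (x powr (- s - 1)) * indicator {a n..} x)) \<partial>lborel)"
    unfolding ennreal_suminf_multc[symmetric] by (simp only: mult_ac)
  also have "\<dots> = (\<Sum>n. \<integral>\<^sup>+x. ennreal (c n) * (ennreal (x powr (- s - 1)) * indicator {a n..} x) \<partial>lborel)"
    by (rule nn_integral_suminf) measurable
  also have "\<dots> = (\<Sum>n. ennreal (c n * a n powr - s / s))"
  proof (rule suminf_cong)
    fix n
    have "(\<integral>\<^sup>+x. ennreal (c n) * (ennreal (x powr (- s - 1)) * indicator {a n..} x) \<partial>lborel) =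
        ennreal (c n) * (\<integral>\<^sup>+x. ennreal (x powr (- s - 1)) * indicator {a n..} x \<partial>lborel)"
      by (rule nn_integral_cmult) measurable
    also have "\<dots> = ennreal (c n * a n powr - s / s)"
      using c[of n] a[of n] s
      by (cases "c n = 0") (auto simp: nn_integral_powr_atLeast ennreal_mult[symmetric])
    finally show "(\<integral>\<^sup>+x. ennreal (c n) * (ennreal (x powr (- s - 1)) * indicator {a n..} x) \<partial>lborel) = \<dots>" .
  qed
  finally show ?thesis .
qed

lemma theta_eq_suminf: "ennreal (theta x) = (\<Sum>n. ennreal (prime_ln n) * indicator {real n..} x)"
proof -
  have "(\<Sum>n. ennreal (prime_ln n) * indicator {real n..} x) =
      (\<Sum>n | prime n \<and> real n \<le> x. ennreal (prime_ln n) * indicator {real n..} x)"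
    by (rule suminf_finite[OF finite_primes_le]) (auto simp: prime_ln_def indicator_def)
  also have "\<dots> = (\<Sum>n | prime n \<and> real n \<le> x. ennreal (prime_ln n))" by (rule sum.cong) auto
  also have "\<dots> = ennreal (\<Sum>n | prime n \<and> real n \<le> x. prime_ln n)" by (rule sum_ennreal) auto
  also have "(\<Sum>n | prime n \<and> real n \<le> x. prime_ln n) = theta x"
    unfolding theta_def by (rule sum.cong) (auto simp: prime_ln_def)
  finally show ?thesis by simp
qed

lemma theta_sqrt_eq_suminf:
  "ennreal (theta (sqrt (4 * x / 3))) = (\<Sum>n. ennreal (prime_ln n) * indicator {3 * real n ^ 2 / 4..} x)"
proof -
  have "real n \<le> sqrt (4 * x / 3) \<longleftrightarrow> 3 * real n ^ 2 / 4 \<le> x" for n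
    using real_sqrt_le_iff[of "real n ^ 2" "4 * x / 3"] by (simp add: field_simps)
  then show ?thesis
    unfolding theta_eq_suminf by (intro suminf_cong) (auto simp: indicator_def)
qed

lemma theta_nonneg: "theta x \<ge> 0"
  unfolding theta_def by (intro sum_nonneg) (auto dest: prime_ge_1_nat)

lemma theta_mono: "mono theta"
proof (rule monoI)
  fix x y :: real assume "x \<le> y"
  then show "theta x \<le> theta y"
    unfolding theta_def using finite_primes_le[of y]
    by (intro sum_mono2) (auto dest: prime_ge_1_nat)
qed

lemma theta_measurable [measurable]: "theta \<in> borel_measurable borel"
  by (rule borel_measurable_mono[OF theta_mono])

lemma theta_eq_0: "x < 2 \<Longrightarrow> theta x = 0"
  unfolding theta_def by (intro sum.neutral) (auto dest: prime_ge_2_nat)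

lemma nn_integral_theta:
  assumes "s > 1"
  shows "(\<integral>\<^sup>+x. ennreal (theta x) * ennreal (x powr (- s - 1)) \<partial>lborel) = ennreal (prime_series_real s / s)"
proof -
  have "(\<integral>\<^sup>+x. ennreal (theta x) * ennreal (x powr (- s - 1)) \<partial>lborel) =
      (\<Sum>n. ennreal (prime_ln n * real n powr - s / s))"
    unfolding theta_eq_suminf
    by (rule nn_integral_step_powr) (use assms in \<open>auto simp: prime_ln_def dest: prime_gt_0_nat split: if_splits\<close>)
  also have "\<dots> = ennreal (\<Sum>n. prime_ln n * real n powr - s / s)"
    using assms by (intro suminf_ennreal2 summable_divide summable_prime_ln_powr) auto
  also have "(\<Sum>n. prime_ln n * real n powr - s / s) = prime_series_real s / s"
    unfolding prime_series_real_def using assms by (intro suminf_divide summable_prime_ln_powr)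
  finally show ?thesis .
qed

lemma nn_integral_theta_sqrt:
  assumes "s > 1 / 2"
  shows "(\<integral>\<^sup>+x. ennreal (theta (sqrt (4 * x / 3))) * ennreal (x powr (- s - 1)) \<partial>lborel) =
    ennreal ((4 / 3) powr s * prime_series_real (2 * s) / s)"
proof -
  have s2: "2 * s > 1" using assms by simp
  have "(\<integral>\<^sup>+x. ennreal (theta (sqrt (4 * x / 3))) * ennreal (x powr (- s - 1)) \<partial>lborel) =
      (\<Sum>n. ennreal (prime_ln n * (3 * real n ^ 2 / 4) powr - s / s))"
    unfolding theta_sqrt_eq_suminf
    by (rule nn_integral_step_powr) (use assms in \<open>auto simp: prime_ln_def dest: prime_gt_0_nat split: if_splits\<close>)
  also have "\<dots> = (\<Sum>n. ennreal ((4 / 3) powr s / s * (prime_ln n * real n powr - (2 * s))))"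
  proof (rule suminf_cong)
    fix n
    have "(3 * real n ^ 2 / 4) powr - s = (4 / 3) powr s * real n powr - (2 * s)"
    proof (cases "n = 0")
      case False
      have "(3 * real n ^ 2 / 4) powr - s = (3 / 4 * real n ^ 2) powr - s" by simp
      also have "\<dots> = (3 / 4) powr - s * (real n ^ 2) powr - s" by (rule powr_mult)
      also have "(3 / 4) powr - s = (4 / 3 :: real) powr s" by (simp add: powr_minus powr_divide)
      also have "(real n ^ 2) powr - s = real n powr - (2 * s)"
      proof -
        have "real n ^ 2 = real n powr 2" using False by simp
        then show ?thesis by (simp only: powr_powr) simp
      qed
      finally show ?thesis .
    qed simp
    then show "ennreal (prime_ln n * (3 * real n ^ 2 / 4) powr - s / s) =
        ennreal ((4 / 3) powr s / s * (prime_ln n * real n powr - (2 * s)))" by (simp add: mult.left_commute)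
  qed
  also have "\<dots> = ennreal (\<Sum>n. (4 / 3) powr s / s * (prime_ln n * real n powr - (2 * s)))"
    using assms by (intro suminf_ennreal2 summable_mult summable_prime_ln_powr[OF s2]) auto
  also have "(\<Sum>n. (4 / 3) powr s / s * (prime_ln n * real n powr - (2 * s))) =
      (4 / 3) powr s / s * prime_series_real (2 * s)"
    unfolding prime_series_real_def by (intro suminf_mult summable_prime_ln_powr[OF s2])
  finally show ?thesis by simp
qed

section \<open>Oscillation of the Chebyshev function\<close>

text \<open>For real \<open>s > 1\<close> this is \<open>1 / (s - 1) - P(s) - P(2 s)\<close>, but
  the formula stays holomorphic across \<open>s = 1\<close> and down to \<open>1 / 3\<close> near
  the real axis.\<close>

definition log_deriv_part :: "complex \<Rightarrow> complex" where
  "log_deriv_part s = deriv zreg s / zreg s + prime_tail s"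

lemma log_deriv_part_holomorphic: "log_deriv_part holomorphic_on {s. Re s > 1 / 3 \<and> zreg s \<noteq> 0}"
  unfolding log_deriv_part_def
proof (intro holomorphic_on_add holomorphic_on_divide)
  have "deriv zreg holomorphic_on {s. Re s > 0}"
    by (rule holomorphic_deriv[OF zreg_holomorphic open_halfspace_Re_gt])
  then show "deriv zreg holomorphic_on {s. Re s > 1 / 3 \<and> zreg s \<noteq> 0}"
    by (rule holomorphic_on_subset) auto
  show "zreg holomorphic_on {s. Re s > 1 / 3 \<and> zreg s \<noteq> 0}"
    by (rule holomorphic_on_subset[OF zreg_holomorphic]) auto
  show "prime_tail holomorphic_on {s. Re s > 1 / 3 \<and> zreg s \<noteq> 0}"
    unfolding holomorphic_on_def
    using prime_tail_field_differentiable field_differentiable_at_within by auto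
qed auto

lemma open_zreg_nonzero:
  assumes "c \<ge> 0"
  shows "open {s. Re s > c \<and> zreg s \<noteq> 0}"
proof -
  have "zreg holomorphic_on {s. Re s > c}"
    by (rule holomorphic_on_subset[OF zreg_holomorphic]) (use assms in auto)
  then have "open ({s. Re s > c} \<inter> zreg -` (- {0}))"
    by (intro continuous_open_preimage holomorphic_on_imp_continuous_on open_halfspace_Re_gt) auto
  moreover have "{s. Re s > c} \<inter> zreg -` (- {0}) = {s. Re s > c \<and> zreg s \<noteq> 0}" by auto
  ultimately show ?thesis by simp
qed

lemma zreg_of_real_nonzero: "s > 0 \<Longrightarrow> zreg (complex_of_real s) \<noteq> 0"
  using zreg_of_real[of s] by force

lemma log_deriv_part_bounded:
  assumes "a > 1 / 3"
  obtains K \<delta> where "\<delta> > 0" "\<And>s. \<bar>s - a\<bar> < \<delta> \<Longrightarrow> norm (log_deriv_part (complex_of_real s)) \<le> K"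
proof -
  have "isCont log_deriv_part (complex_of_real a)"
    using continuous_on_interior[OF holomorphic_on_imp_continuous_on[OF log_deriv_part_holomorphic], of "complex_of_real a"]
      assms zreg_of_real_nonzero[of a] open_zreg_nonzero[of "1 / 3"]
    by (simp add: interior_open)
  then obtain \<delta> where \<delta>: "\<delta> > 0"
      "\<And>z. dist z (complex_of_real a) < \<delta> \<Longrightarrow> dist (log_deriv_part z) (log_deriv_part (complex_of_real a)) < 1"
    unfolding continuous_at_eps_delta by (metis zero_less_one)
  show ?thesis
  proof (rule that[OF \<delta>(1)])
    fix s assume "\<bar>s - a\<bar> < \<delta>"
    then have "dist (complex_of_real s) (complex_of_real a) < \<delta>"
      by (simp add: dist_norm flip: of_real_diff)
    then have "norm (log_deriv_part (complex_of_real s) - log_deriv_part (complex_of_real a)) < 1"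
      using \<delta>(2) by (simp add: dist_norm)
    then show "norm (log_deriv_part (complex_of_real s)) \<le> norm (log_deriv_part (complex_of_real a)) + 1"
      using norm_triangle_ineq2[of "log_deriv_part (complex_of_real s)" "log_deriv_part (complex_of_real a)"]
      by simp
  qed
qed

lemma log_deriv_part_eq:
  assumes "s > 1"
  shows "log_deriv_part (complex_of_real s) =
    complex_of_real (1 / (s - 1) - prime_series_real s - prime_series_real (2 * s))"
  using log_deriv_zreg[OF assms] prime_series_of_real[OF assms] prime_series_of_real[of "2 * s"] assms
  by (simp add: log_deriv_part_def)

text \<open>\<open>log_deriv_part\<close> is bounded near 1, and so is \<open>P(2 s)\<close>; hence
  \<open>P\<close> inherits the pole of \<open>1 / (s - 1)\<close>.\<close>

lemma prime_series_real_lower: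
  obtains K \<delta> where "\<delta> > 0" "\<And>s. 1 < s \<Longrightarrow> s < 1 + \<delta> \<Longrightarrow> prime_series_real s \<ge> 1 / (s - 1) - K"
proof -
  obtain K \<delta> where K: "\<delta> > 0" "\<And>s. \<bar>s - 1\<bar> < \<delta> \<Longrightarrow> norm (log_deriv_part (complex_of_real s)) \<le> K"
    by (rule log_deriv_part_bounded[of 1]) auto
  \<comment> \<open>Since \<open>2 * s > 2\<close>, the value at \<open>3 / 2\<close> dominates
    \<open>P(2 s)\<close>.\<close>
  define P where "P = prime_series_real (3 / 2)"
  show ?thesis
  proof (rule that[OF K(1)])
    fix s :: real assume s: "1 < s" "s < 1 + \<delta>"
    have "prime_series_real (2 * s) \<le> P"
      unfolding P_def prime_series_real_def
    proof (intro suminf_le summable_prime_ln_powr)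
      fix n
      show "prime_ln n * real n powr - (2 * s) \<le> prime_ln n * real n powr - (3 / 2)"
        using s by (cases "n = 0") (auto intro!: mult_left_mono powr_mono)
    qed (use s in auto)
    moreover have "\<bar>1 / (s - 1) - prime_series_real s - prime_series_real (2 * s)\<bar> \<le> K"
      using K(2)[of s] s unfolding log_deriv_part_eq[OF s(1)] norm_of_real by simp
    ultimately show "prime_series_real s \<ge> 1 / (s - 1) - (K + P)" by linarith
  qed
qed

context
  fixes C :: real
  assumes C: "C \<ge> 0"
    and bound: "\<And>x. x \<ge> 1 \<Longrightarrow> theta x + theta (sqrt (4 * x / 3)) \<le> x + C * x powr (1 / 4)"
begin

text \<open>The division by \<open>x\<close> supplies the extra power in the Mellin kernel
  \<open>x powr (- s - 1)\<close>. Below 1 the weight is 0, matching the exponent function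
  \<open>ln (max 1 x)\<close>, which is nonnegative everywhere.\<close>

definition gap_weight :: "real \<Rightarrow> real" where
  "gap_weight x = (if 1 \<le> x then (x + C * x powr (1 / 4) - theta x - theta (sqrt (4 * x / 3))) / x else 0)"

text \<open>The summand 1 completes \<open>1 / (s - 1)\<close> to \<open>s / (s - 1)\<close>, the
  transform of \<open>x\<close> times \<open>s\<close>. As \<open>log_deriv_part\<close> already
  holds \<open>- P(2 s)\<close>, only \<open>(4 / 3) powr s - 1\<close> remains as its
  factor.\<close>

definition gap_transform :: "complex \<Rightarrow> complex" where
  "gap_transform s = (1 + log_deriv_part s - (of_real (4 / 3) powr s - 1) * prime_series (2 * s)
     + of_real C * s / (s - 1 / 4)) / s"

lemma gap_weight_nonneg: "gap_weight x \<ge> 0"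
  using bound[of x] by (auto simp: gap_weight_def intro!: divide_nonneg_nonneg)

lemma gap_weight_measurable: "gap_weight \<in> borel_measurable lborel"
  unfolding gap_weight_def[abs_def] by measurable

lemma laplace_gap_weight:
  assumes s: "s > 1"
  shows "laplace lborel gap_weight (\<lambda>x. ln (max 1 x)) s =
    ennreal (1 / (s - 1) + C / (s - 1 / 4) - prime_series_real s / s - (4 / 3) powr s * prime_series_real (2 * s) / s)"
    (is "?L = ennreal (?A - ?P - ?Q)")
    and "1 / (s - 1) + C / (s - 1 / 4) - prime_series_real s / s - (4 / 3) powr s * prime_series_real (2 * s) / s \<ge> 0"
proof -
  let ?T1 = "\<lambda>x. ennreal (theta x) * ennreal (x powr (- s - 1))"
  let ?T2 = "\<lambda>x. ennreal (theta (sqrt (4 * x / 3))) * ennreal (x powr (- s - 1))"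
  let ?E1 = "\<lambda>x. ennreal (x powr (- (s - 1) - 1)) * indicator {1..} x"
  let ?E2 = "\<lambda>x. ennreal C * (ennreal (x powr (- (s - 1 / 4) - 1)) * indicator {1..} x)"
  have pw: "ennreal (gap_weight x * exp (- s * ln (max 1 x))) + (?T1 x + ?T2 x) = ?E1 x + ?E2 x" for x
  proof (cases "x \<ge> 1")
    case True
    define y where "y = x powr (- s - 1)"
    have e: "exp (- s * ln (max 1 x)) / x = y"
    proof -
      have "max 1 x = x" "x powr - s = exp (- s * ln x)" using True by (auto simp: powr_def)
      then show ?thesis using True by (simp only: y_def powr_diff powr_one)
    qed
    have y1: "x * y = x powr (- (s - 1) - 1)"
      using True by (simp add: y_def powr_mult_base)
    have y2: "x powr (1 / 4) * y = x powr (- (s - 1 / 4) - 1)"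
      by (simp add: y_def flip: powr_add)
    have "gap_weight x * exp (- s * ln (max 1 x)) =
        (x + C * x powr (1 / 4) - theta x - theta (sqrt (4 * x / 3))) * (exp (- s * ln (max 1 x)) / x)"
      using True by (simp add: gap_weight_def)
    also have "\<dots> = x powr (- (s - 1) - 1) + C * x powr (- (s - 1 / 4) - 1) - theta x * y - theta (sqrt (4 * x / 3)) * y"
      unfolding e y1[symmetric] y2[symmetric] by (simp add: algebra_simps)
    finally have eq: "gap_weight x * exp (- s * ln (max 1 x)) + (theta x * y + theta (sqrt (4 * x / 3)) * y) =
        x powr (- (s - 1) - 1) + C * x powr (- (s - 1 / 4) - 1)" by simp
    have y0: "y \<ge> 0" by (simp add: y_def)
    have "ennreal (gap_weight x * exp (- s * ln (max 1 x))) + (?T1 x + ?T2 x) =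
        ennreal (gap_weight x * exp (- s * ln (max 1 x)) + (theta x * y + theta (sqrt (4 * x / 3)) * y))"
      using gap_weight_nonneg[of x] theta_nonneg y0
      by (simp add: ennreal_plus ennreal_mult y_def[symmetric] del: ennreal_plus[symmetric])
    also have "\<dots> = ?E1 x + ?E2 x"
      unfolding eq using True C by (simp add: ennreal_mult)
    finally show ?thesis .
  next
    case False
    then have "sqrt (4 * x / 3) < 2"
      by (intro real_sqrt_less_iff[THEN iffD2, of _ 4, simplified]) simp
    then show ?thesis using False by (simp add: gap_weight_def theta_eq_0)
  qed
  have m [measurable]: "gap_weight \<in> borel_measurable borel"
    using gap_weight_measurable by simp
  have "?L + (ennreal ?P + ennreal ?Q) = (\<integral>\<^sup>+x. ?E1 x + ?E2 x \<partial>lborel)"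
  proof -
    have "(\<integral>\<^sup>+x. ?E1 x + ?E2 x \<partial>lborel) = ?L + (\<integral>\<^sup>+x. ?T1 x + ?T2 x \<partial>lborel)"
      unfolding pw[symmetric] laplace_def by (rule nn_integral_add) measurable
    also have "(\<integral>\<^sup>+x. ?T1 x + ?T2 x \<partial>lborel) = (\<integral>\<^sup>+x. ?T1 x \<partial>lborel) + (\<integral>\<^sup>+x. ?T2 x \<partial>lborel)"
      by (rule nn_integral_add) measurable
    finally show ?thesis using s by (simp add: nn_integral_theta nn_integral_theta_sqrt)
  qed
  also have "\<dots> = ennreal (1 / (s - 1)) + ennreal C * ennreal (1 / (s - 1 / 4))"
  proof -
    have "(\<integral>\<^sup>+x. ?E1 x + ?E2 x \<partial>lborel) = (\<integral>\<^sup>+x. ?E1 x \<partial>lborel) + (\<integral>\<^sup>+x. ?E2 x \<partial>lborel)"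
      by (rule nn_integral_add) measurable
    also have "(\<integral>\<^sup>+x. ?E2 x \<partial>lborel) =
        ennreal C * (\<integral>\<^sup>+x. ennreal (x powr (- (s - 1 / 4) - 1)) * indicator {1..} x \<partial>lborel)"
      by (rule nn_integral_cmult) measurable
    finally show ?thesis
      using nn_integral_powr_atLeast[of 1 "s - 1"] nn_integral_powr_atLeast[of 1 "s - 1 / 4"] s by simp
  qed
  also have "\<dots> = ennreal ?A"
    using s C by (simp add: ennreal_plus ennreal_mult[symmetric])
  finally have sum: "?L + (ennreal ?P + ennreal ?Q) = ennreal ?A" .
  have nn: "prime_series_real t \<ge> 0" if "t > 1" for t
    unfolding prime_series_real_def using summable_prime_ln_powr[OF that] by (intro suminf_nonneg) auto
  have P: "?P \<ge> 0" using nn[of s] s by simp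
  have Q: "?Q \<ge> 0" using nn[of "2 * s"] s by simp
  have A: "?A \<ge> 0" using s C by simp
  have fin: "?L \<noteq> top" using sum by (metis ennreal_add_eq_top ennreal_neq_top)
  then obtain y where y: "?L = ennreal y" "y \<ge> 0" by (cases ?L) auto
  have "ennreal (y + (?P + ?Q)) = ennreal ?A"
    using sum y P Q by (simp add: ennreal_plus)
  moreover have "y + (?P + ?Q) \<ge> 0" using y P Q by linarith
  ultimately have "y + (?P + ?Q) = ?A" using ennreal_inj A by blast
  then have "y = ?A - ?P - ?Q" by linarith
  then show "?L = ennreal (?A - ?P - ?Q)" "?A - ?P - ?Q \<ge> 0" using y by simp_all
qed

lemma laplace_agrees_gap:
  assumes s: "s > 1"
  shows "laplace_agrees lborel gap_weight (\<lambda>x. ln (max 1 x)) gap_transform s"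
proof -
  define y where "y = 1 / (s - 1) + C / (s - 1 / 4) - prime_series_real s / s - (4 / 3) powr s * prime_series_real (2 * s) / s"
  have s2: "2 * s > 1" using s by simp
  have p: "prime_series (2 * complex_of_real s) = complex_of_real (prime_series_real (2 * s))"
    using prime_series_of_real[OF s2] by simp
  have q: "complex_of_real (4 / 3) powr complex_of_real s = complex_of_real ((4 / 3) powr s)"
    by (rule powr_of_real) simp
  have "gap_transform (complex_of_real s) = complex_of_real
      ((1 + (1 / (s - 1) - prime_series_real s - prime_series_real (2 * s))
        - ((4 / 3) powr s - 1) * prime_series_real (2 * s) + C * s / (s - 1 / 4)) / s)"
    unfolding gap_transform_def p q log_deriv_part_eq[OF s] by simp
  also have "((1 + (1 / (s - 1) - prime_series_real s - prime_series_real (2 * s))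
        - ((4 / 3) powr s - 1) * prime_series_real (2 * s) + C * s / (s - 1 / 4)) / s) = y"
  proof -
    have "(1 + 1 / (s - 1)) / s = 1 / (s - 1)" using s by (simp add: field_simps)
    moreover have "C * s / (s - 1 / 4) / s = C / (s - 1 / 4)" using s by simp
    ultimately show ?thesis unfolding y_def
      by (simp add: add_divide_distrib diff_divide_distrib algebra_simps)
  qed
  finally show ?thesis
    using laplace_gap_weight[OF s] unfolding laplace_agrees_def y_def by blast
qed

lemma gap_transform_holomorphic: "gap_transform holomorphic_on {s. Re s > 1 / 2 \<and> zreg s \<noteq> 0}"
proof -
  let ?U = "{s. Re s > 1 / 2 \<and> zreg s \<noteq> 0}"
  have l: "log_deriv_part holomorphic_on ?U"
    by (rule holomorphic_on_subset[OF log_deriv_part_holomorphic]) auto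
  have p: "(\<lambda>s. prime_series (2 * s)) holomorphic_on ?U"
  proof -
    have "prime_series holomorphic_on {s. Re s > 1}"
      unfolding holomorphic_on_def
      using prime_series_field_differentiable field_differentiable_at_within by auto
    then have "prime_series \<circ> (\<lambda>s. 2 * s) holomorphic_on ?U"
      by (intro holomorphic_on_compose_gen[where t = "{s. Re s > 1}"]) (auto intro!: holomorphic_intros)
    then show ?thesis by (simp add: o_def)
  qed
  show ?thesis
    unfolding gap_transform_def
    by (intro holomorphic_intros l p) (auto simp: complex_eq_iff)
qed

text \<open>Around each real \<open>s > 1 / 2\<close> a small disc avoids the zeros of
  \<open>zreg\<close>, so agreement spreads from \<open>s > 1\<close> down to \<open>1 / 2\<close>;
  an integral of a nonnegative weight is nonnegative.\<close>

lemma gap_transform_nonneg: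
  assumes "s > 1 / 2"
  shows "Re (gap_transform (complex_of_real s)) \<ge> 0"
proof -
  have "laplace_agrees lborel gap_weight (\<lambda>x. ln (max 1 x)) gap_transform s"
  proof (rule laplace_agrees_extend[OF gap_weight_measurable _ gap_weight_nonneg _ _ laplace_agrees_gap assms])
    show "(\<lambda>x::real. ln (max 1 x)) \<in> borel_measurable lborel" by measurable
    show "ln (max 1 x) \<ge> 0" for x :: real by simp
    show "\<exists>r>0. gap_transform holomorphic_on ball (complex_of_real s) r" if s: "s > 1 / 2" for s
    proof -
      have "complex_of_real s \<in> {s. Re s > 1 / 2 \<and> zreg s \<noteq> 0}"
        using s zreg_of_real_nonzero[of s] by simp
      then obtain r where "r > 0" "ball (complex_of_real s) r \<subseteq> {s. Re s > 1 / 2 \<and> zreg s \<noteq> 0}"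
        by (rule openE[OF open_zreg_nonzero[of "1 / 2"], rotated]) simp_all
      then show ?thesis using gap_transform_holomorphic holomorphic_on_subset by blast
    qed
  qed
  then show ?thesis by (auto simp: laplace_agrees_def)
qed

lemma gap_contradiction: False
proof -
  obtain K1 d1 where 1: "d1 > 0" "\<And>s. \<bar>s - 1 / 2\<bar> < d1 \<Longrightarrow> norm (log_deriv_part (complex_of_real s)) \<le> K1"
    by (rule log_deriv_part_bounded[of "1 / 2"]) auto
  obtain K2 d2 where 2: "d2 > 0" "\<And>s. 1 < s \<Longrightarrow> s < 1 + d2 \<Longrightarrow> prime_series_real s \<ge> 1 / (s - 1) - K2"
    using prime_series_real_lower by blast
  \<comment> \<open>10 is the reciprocal of the lower bound \<open>1 / 10\<close> for
    \<open>(4 / 3) powr s - 1\<close>, \<open>4 * C\<close> bounds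
    \<open>C * s / (s - 1 / 4)\<close>, and \<open>K2\<close> is the loss in the lower bound
    \<open>1 / (2 * h) - K2\<close> for \<open>P\<close>.\<close>
  define M where "M = 10 * (1 + \<bar>K1\<bar> + 4 * C) + \<bar>K2\<bar> + 1"
  have M: "M > 0" using C by (simp add: M_def)
  define h where "h = min (min d1 (d2 / 2)) (min (1 / (2 * M)) 1) / 2"
  have h: "h > 0" "h < d1" "2 * h < d2" "h < 1" "2 * h < 1 / M"
  proof -
    define m where "m = min (min d1 (d2 / 2)) (min (1 / (2 * M)) 1)"
    have "m > 0" "m \<le> d1" "m \<le> d2 / 2" "m \<le> 1 / (2 * M)" "m \<le> 1"
      unfolding m_def using 1(1) 2(1) M by auto
    moreover have "h = m / 2" by (simp add: h_def m_def)
    moreover have "1 / (2 * M) < 1 / M" using M by (simp add: field_simps)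
    ultimately show "h > 0" "h < d1" "2 * h < d2" "h < 1" "2 * h < 1 / M" using 2(1) by linarith+
  qed
  define s where "s = 1 / 2 + h"
  have s: "s > 1 / 2" "s < 3 / 2" using h by (auto simp: s_def)
  have s2: "2 * s > 1" using s by simp
  define P where "P = prime_series_real (2 * s)"
  have "P \<ge> 1 / (2 * h) - K2" using 2(2)[of "2 * s"] h by (simp add: P_def s_def algebra_simps)
  moreover have "1 / (2 * h) > M" using h(1,5) M by (simp add: field_simps)
  ultimately have P: "P > 10 * (1 + \<bar>K1\<bar> + 4 * C)" by (simp add: M_def)
  have p: "prime_series (2 * complex_of_real s) = complex_of_real P"
    using prime_series_of_real[OF s2] by (simp add: P_def)
  have q: "complex_of_real (4 / 3) powr complex_of_real s = complex_of_real ((4 / 3) powr s)"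
    by (rule powr_of_real) simp
  have "Re (gap_transform (complex_of_real s)) =
      (1 + Re (log_deriv_part (complex_of_real s)) - ((4 / 3) powr s - 1) * P + C * s / (s - 1 / 4)) / s"
  proof -
    have "gap_transform (complex_of_real s) = (1 + log_deriv_part (complex_of_real s)
        - complex_of_real (((4 / 3) powr s - 1) * P) + complex_of_real (C * s / (s - 1 / 4))) / complex_of_real s"
      unfolding gap_transform_def p q by simp
    then show ?thesis by (simp only: Re_divide_of_real plus_complex.sel minus_complex.sel one_complex.sel Re_complex_of_real)
  qed
  then have ge: "1 + Re (log_deriv_part (complex_of_real s)) - ((4 / 3) powr s - 1) * P + C * s / (s - 1 / 4) \<ge> 0"
    using gap_transform_nonneg[OF s(1)] s(1) by (simp add: zero_le_divide_iff)
  have "Re (log_deriv_part (complex_of_real s)) \<le> \<bar>K1\<bar>"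
    using 1(2)[of s] h complex_Re_le_cmod[of "log_deriv_part (complex_of_real s)"] by (simp add: s_def)
  moreover have "C * s / (s - 1 / 4) \<le> 4 * C"
  proof -
    have "s \<le> 4 * (s - 1 / 4)" using s by simp
    then have "C * s \<le> C * (4 * (s - 1 / 4))" using C by (rule mult_left_mono)
    then show ?thesis using s by (simp add: field_simps)
  qed
  moreover have "((4 / 3) powr s - 1) * P \<ge> (1 / 10) * P"
  proof (rule mult_right_mono)
    \<comment> \<open>Here it matters that \<open>4 / 3\<close> exceeds 1: the factor of
      \<open>P(2 s)\<close> stays away from 0 as \<open>s\<close> tends to
      \<open>1 / 2\<close>.\<close>
    have "(11 / 10 :: real) \<le> sqrt (4 / 3)" by (rule real_le_rsqrt) (simp add: power2_eq_square)
    also have "\<dots> = (4 / 3) powr (1 / 2)" by (simp add: powr_half_sqrt)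
    also have "\<dots> \<le> (4 / 3) powr s" using s by (intro powr_mono) auto
    finally show "1 / 10 \<le> (4 / 3) powr s - 1" by simp
    have "0 \<le> 10 * (1 + \<bar>K1\<bar> + 4 * C)" using C by simp
    then show "0 \<le> P" using P by linarith
  qed
  ultimately show False using ge P by simp
qed

end

lemma theta_add_theta_sqrt_unbounded:
  "\<exists>x\<ge>M. theta x + theta (sqrt (4 * x / 3)) \<ge> x + 1 + ln (x + 1)"
proof (rule ccontr)
  assume neg: "\<not> (\<exists>x\<ge>M. theta x + theta (sqrt (4 * x / 3)) \<ge> x + 1 + ln (x + 1))"
  \<comment> \<open>An exponent in place of \<open>1 / 4\<close> must be positive to beat the
    logarithm and below \<open>1 / 2\<close> to keep its pole out of the way.\<close>
  have "eventually (\<lambda>x::real. 1 + ln (x + 1) \<le> x powr (1 / 4)) at_top" by real_asymp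
  then obtain X where X: "\<And>x::real. x \<ge> X \<Longrightarrow> 1 + ln (x + 1) \<le> x powr (1 / 4)"
    by (auto simp: eventually_at_top_linorder)
  define B where "B = max M (max X 1)"
  \<comment> \<open>The summand 1 handles \<open>x >= B\<close>; the \<open>theta\<close> values at
    \<open>B\<close> bound those for \<open>x < B\<close> by monotonicity.\<close>
  define C where "C = 1 + theta B + theta (sqrt (4 * B / 3))"
  have C: "C \<ge> 1" using theta_nonneg by (simp add: C_def)
  show False
  proof (rule gap_contradiction)
    show "C \<ge> 0" using C by simp
    fix x :: real assume x: "x \<ge> 1"
    have p: "x powr (1 / 4) \<ge> 1" using x by (simp add: ge_one_powr_ge_zero)
    show "theta x + theta (sqrt (4 * x / 3)) \<le> x + C * x powr (1 / 4)"
    proof (cases "x \<ge> B")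
      case True
      then have "theta x + theta (sqrt (4 * x / 3)) < x + 1 + ln (x + 1)"
        using neg by (force simp: B_def)
      also have "\<dots> \<le> x + x powr (1 / 4)" using X[of x] True by (simp add: B_def)
      also have "\<dots> \<le> x + C * x powr (1 / 4)" using C p by (simp add: mult_le_cancel_right1)
      finally show ?thesis by simp
    next
      case False
      then have "theta x \<le> theta B" "theta (sqrt (4 * x / 3)) \<le> theta (sqrt (4 * B / 3))"
        by (auto intro!: monoD[OF theta_mono])
      then have "theta x + theta (sqrt (4 * x / 3)) \<le> C" by (simp add: C_def)
      also have "\<dots> \<le> C * x powr (1 / 4)" using C p by (simp add: mult_le_cancel_left1)
      finally show ?thesis using x by simp
    qed
  qed
qed

theorem theorem6:
  shows "infinite {N::nat. colossally_abundant N \<and> GA1 N}"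
  by (rule infinite_colossally_abundant_GA1I) (rule theta_add_theta_sqrt_unbounded)

end
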